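(* Let $\Lambda$ be a row-finite $k$-graph with no sources and $R$ a commutative ring with $1$. Then $\mathcal{M}=\mathcal{D}'$, where $\mathcal{D}'=\{a\in{\rm KP}_R(\Lambda): ad=da\text{ for all }d\in\mathcal{D}\}$. In particular, $\mathcal{M}$ is a maximal commutative subalgebra of ${\rm KP}_R(\Lambda)$.
   Context: A $k$-graph is a countable category $\Lambda$ (vertices $\Lambda^0$, paths, maps $r,s$) with a degree functor $d:\Lambda\to\mathbb{N}^k$ satisfying unique factorization: if $d(\lambda)=m+n$ there are unique $\mu,\nu$ with $s(\mu)=r(\nu)$, $d(\mu)=m,d(\nu)=n$, $\lambda=\mu\nu$. $v\Lambda=\{\lambda: r(\lambda)=v\}$, $v\Lambda^n$ those of degree $n$; row-finite with no sources means each $v\Lambda^n$ is finite and nonempty. ${\rm KP}_R(\Lambda)$ is the universal $R$-algebra generated by $p_v$ ($v\in\Lambda^0$), $s_\lambda,s_{\lambda^*}$ ($d(\lambda)\ne0$) with relations (KP1) $p_v$ mutually orthogonal idempotents; (KP2) $s_\lambda s_\mu=s_{\lambda\mu}$, $s_{\mu^*}s_{\lambda^*}=s_{(\lambda\mu)^*}$, $p_{r(\lambda)}s_\lambda=s_\lambda=s_\lambda p_{s(\lambda)}$, $p_{s(\lambda)}s_{\lambda^*}=s_{\lambda^*}=s_{\lambda^*}p_{r(\lambda)}$ when $r(\mu)=s(\lambda)$; (KP3) $s_{\lambda^*}s_\mu=\delta_{\lambda,\mu}p_{s(\lambda)}$ when $d(\lambda)=d(\mu)$; (KP4) $p_v=\sum_{\lambda\in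 v\Lambda^n}s_\lambda s_{\lambda^*}$ for $n\ne0$. Convention $s_v=s_{v^*}=p_v$. $\mathcal{D}$ is the $R$-subalgebra generated by $\{s_\mu s_{\mu^*}:\mu\in\Lambda\}$. A pair $(\alpha,\beta)\in\Lambda\times\Lambda$ with $s(\alpha)=s(\beta)$ is a cycline pair if $s_{\alpha\gamma}s_{(\alpha\gamma)^*}=s_{\beta\gamma}s_{(\beta\gamma)^*}$ for all $\gamma\in s(\alpha)\Lambda$. The cycline subalgebra $\mathcal{M}$ is the $R$-subalgebra generated by $\{s_\alpha s_{\beta^*}: (\alpha,\beta)\text{ cycline}\}$. *)

theory Defs
  imports Main "HOL-Library.Countable_Set"
begin

text \<open>A k-graph is a small category whose objects are identified with its identity
morphisms (the vertices).  Paths (morphisms) live in the set kg_mor; vertices in kg_obj;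
kg_r / kg_s are range and source; kg_comp l m is the composite l m (defined when
kg_s l = kg_r m); kg_d is the degree functor into N^k, represented as functions
nat => nat vanishing from index k on.\<close>

record 'p kgraph =
  kg_mor  :: "'p set"
  kg_obj  :: "'p set"
  kg_r    :: "'p \<Rightarrow> 'p"
  kg_s    :: "'p \<Rightarrow> 'p"
  kg_comp :: "'p \<Rightarrow> 'p \<Rightarrow> 'p"
  kg_d    :: "'p \<Rightarrow> nat \<Rightarrow> nat"

definition is_kgraph :: "'p kgraph \<Rightarrow> nat \<Rightarrow> bool" where
  "is_kgraph K k \<longleftrightarrow>
     countable (kg_mor K) \<and>
     kg_obj K \<subseteq> kg_mor K \<and>
     (\<forall>l\<in>kg_mor K. kg_r K l \<in> kg_obj K \<and> kg_s K l \<in> kg_obj K) \<and>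
     (\<forall>v\<in>kg_obj K. kg_r K v = v \<and> kg_s K v = v) \<and>
     (\<forall>l\<in>kg_mor K. \<forall>m\<in>kg_mor K. kg_s K l = kg_r K m \<longrightarrow>
         kg_comp K l m \<in> kg_mor K \<and> kg_r K (kg_comp K l m) = kg_r K l \<and>
         kg_s K (kg_comp K l m) = kg_s K m) \<and>
     (\<forall>l\<in>kg_mor K. \<forall>m\<in>kg_mor K. \<forall>n\<in>kg_mor K.
         kg_s K l = kg_r K m \<and> kg_s K m = kg_r K n \<longrightarrow>
         kg_comp K (kg_comp K l m) n = kg_comp K l (kg_comp K m n)) \<and>
     (\<forall>l\<in>kg_mor K. kg_comp K (kg_r K l) l = l \<and> kg_comp K l (kg_s K l) = l) \<and>
     (\<forall>l\<in>kg_mor K. \<forall>i\<ge>k. kg_d K l i = 0) \<and>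
     (\<forall>l\<in>kg_mor K. \<forall>m\<in>kg_mor K. kg_s K l = kg_r K m \<longrightarrow>
         kg_d K (kg_comp K l m) = (\<lambda>i. kg_d K l i + kg_d K m i)) \<and>
     (\<forall>l\<in>kg_mor K. \<forall>m n. kg_d K l = (\<lambda>i. m i + n i) \<longrightarrow>
         (\<exists>!p. fst p \<in> kg_mor K \<and> snd p \<in> kg_mor K \<and> kg_s K (fst p) = kg_r K (snd p) \<and>
               kg_d K (fst p) = m \<and> kg_d K (snd p) = n \<and> l = kg_comp K (fst p) (snd p)))"

definition row_finite_no_sources :: "'p kgraph \<Rightarrow> nat \<Rightarrow> bool" where
  "row_finite_no_sources K k \<longleftrightarrow>
     (\<forall>v\<in>kg_obj K. \<forall>n. (\<forall>i\<ge>k. n i = 0) \<longrightarrow>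
        finite {l\<in>kg_mor K. kg_r K l = v \<and> kg_d K l = n} \<and>
        {l\<in>kg_mor K. kg_r K l = v \<and> kg_d K l = n} \<noteq> {})"

datatype 'p kpgen = Pv 'p | Sg 'p | Sst 'p

definition kp_gens :: "'p kgraph \<Rightarrow> 'p kpgen set" where
  "kp_gens K = Pv ` kg_obj K \<union> Sg ` {l\<in>kg_mor K. kg_d K l \<noteq> (\<lambda>_. 0)}
                \<union> Sst ` {l\<in>kg_mor K. kg_d K l \<noteq> (\<lambda>_. 0)}"

text \<open>Elements of the free algebra: finitely supported R-valued functions on words
in the generators.\<close>
definition fa_carrier :: "'g set \<Rightarrow> ('g list \<Rightarrow> 'r::comm_ring_1) set" where
  "fa_carrier G = {f. finite {w. f w \<noteq> 0} \<and> (\<forall>w. f w \<noteq> 0 \<longrightarrow> set w \<subseteq> G)}"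

definition fa_mult :: "('g list \<Rightarrow> 'r::comm_ring_1) \<Rightarrow> ('g list \<Rightarrow> 'r) \<Rightarrow> 'g list \<Rightarrow> 'r" where
  "fa_mult f g = (\<lambda>w. \<Sum>p\<in>{p. fst p @ snd p = w}. f (fst p) * g (snd p))"

definition fa_gen :: "'g \<Rightarrow> 'g list \<Rightarrow> 'r::comm_ring_1" where
  "fa_gen x = (\<lambda>w. if w = [x] then 1 else 0)"

definition fa_sub :: "('g list \<Rightarrow> 'r::comm_ring_1) \<Rightarrow> ('g list \<Rightarrow> 'r) \<Rightarrow> 'g list \<Rightarrow> 'r" where
  "fa_sub f g = (\<lambda>w. f w - g w)"

text \<open>Convention s_v = s_{v*} = p_v for paths of degree 0.\<close>
definition sgen :: "'p kgraph \<Rightarrow> 'p \<Rightarrow> 'p kpgen" where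
  "sgen K l = (if kg_d K l = (\<lambda>_. 0) then Pv l else Sg l)"

definition sstgen :: "'p kgraph \<Rightarrow> 'p \<Rightarrow> 'p kpgen" where
  "sstgen K l = (if kg_d K l = (\<lambda>_. 0) then Pv l else Sst l)"

definition fX :: "'p kgraph \<Rightarrow> 'p \<Rightarrow> 'p kpgen list \<Rightarrow> 'r::comm_ring_1" where
  "fX K l = fa_gen (sgen K l)"

definition fY :: "'p kgraph \<Rightarrow> 'p \<Rightarrow> 'p kpgen list \<Rightarrow> 'r::comm_ring_1" where
  "fY K l = fa_gen (sstgen K l)"

definition kp_rels :: "'p kgraph \<Rightarrow> nat \<Rightarrow> ('p kpgen list \<Rightarrow> 'r::comm_ring_1) set" where
  "kp_rels K k =
     {fa_sub (fa_mult (fX K v) (fX K w)) (if v = w then fX K v else (\<lambda>_. 0))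
        | v w. v \<in> kg_obj K \<and> w \<in> kg_obj K}
   \<union> {fa_sub (fa_mult (fX K l) (fX K m)) (fX K (kg_comp K l m))
        | l m. l \<in> kg_mor K \<and> m \<in> kg_mor K \<and> kg_r K m = kg_s K l}
   \<union> {fa_sub (fa_mult (fY K m) (fY K l)) (fY K (kg_comp K l m))
        | l m. l \<in> kg_mor K \<and> m \<in> kg_mor K \<and> kg_r K m = kg_s K l}
   \<union> {fa_sub (fa_mult (fX K (kg_r K l)) (fX K l)) (fX K l) | l. l \<in> kg_mor K}
   \<union> {fa_sub (fa_mult (fX K l) (fX K (kg_s K l))) (fX K l) | l. l \<in> kg_mor K}
   \<union> {fa_sub (fa_mult (fX K (kg_s K l)) (fY K l)) (fY K l) | l. l \<in> kg_mor K}
   \<union> {fa_sub (fa_mult (fY K l) (fX K (kg_r K l))) (fY K l) | l. l \<in> kg_mor K}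
   \<union> {fa_sub (fa_mult (fY K l) (fX K m)) (if l = m then fX K (kg_s K l) else (\<lambda>_. 0))
        | l m. l \<in> kg_mor K \<and> m \<in> kg_mor K \<and> kg_d K l = kg_d K m}
   \<union> {fa_sub (fX K v)
        (\<lambda>w. \<Sum>l\<in>{l\<in>kg_mor K. kg_r K l = v \<and> kg_d K l = n}. fa_mult (fX K l) (fY K l) w)
        | v n. v \<in> kg_obj K \<and> (\<forall>i\<ge>k. n i = 0) \<and> n \<noteq> (\<lambda>_. 0)}"

inductive_set kp_ideal :: "'p kgraph \<Rightarrow> nat \<Rightarrow> ('p kpgen list \<Rightarrow> 'r::comm_ring_1) set"
  for K k where
  base: "x \<in> kp_rels K k \<Longrightarrow> x \<in> kp_ideal K k"
| zero: "(\<lambda>_. 0) \<in> kp_ideal K k"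
| add: "x \<in> kp_ideal K k \<Longrightarrow> y \<in> kp_ideal K k \<Longrightarrow> (\<lambda>w. x w + y w) \<in> kp_ideal K k"
| lmult: "x \<in> kp_ideal K k \<Longrightarrow> a \<in> fa_carrier (kp_gens K) \<Longrightarrow> fa_mult a x \<in> kp_ideal K k"
| rmult: "x \<in> kp_ideal K k \<Longrightarrow> a \<in> fa_carrier (kp_gens K) \<Longrightarrow> fa_mult x a \<in> kp_ideal K k"

text \<open>Congruence classes modulo the ideal.  KP_R(Lambda) (which is non-unital in general)
is realised as the classes of elements with zero constant term, i.e. the image of the
free non-unital algebra.\<close>
definition kp_cls :: "'p kgraph \<Rightarrow> nat \<Rightarrow> ('p kpgen list \<Rightarrow> 'r::comm_ring_1) \<Rightarrow> ('p kpgen list \<Rightarrow> 'r) set" where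
  "kp_cls K k x = {y \<in> fa_carrier (kp_gens K). fa_sub y x \<in> kp_ideal K k}"

definition KP :: "'p kgraph \<Rightarrow> nat \<Rightarrow> ('p kpgen list \<Rightarrow> 'r::comm_ring_1) set set" where
  "KP K k = kp_cls K k ` {x \<in> fa_carrier (kp_gens K). x [] = 0}"

definition kp_rep :: "('g list \<Rightarrow> 'r::comm_ring_1) set \<Rightarrow> 'g list \<Rightarrow> 'r" where
  "kp_rep X = (SOME x. x \<in> X)"

definition kp_mult :: "'p kgraph \<Rightarrow> nat \<Rightarrow> ('p kpgen list \<Rightarrow> 'r::comm_ring_1) set \<Rightarrow> ('p kpgen list \<Rightarrow> 'r) set \<Rightarrow> ('p kpgen list \<Rightarrow> 'r) set" where
  "kp_mult K k X Y = kp_cls K k (fa_mult (kp_rep X) (kp_rep Y))"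

definition kp_add :: "'p kgraph \<Rightarrow> nat \<Rightarrow> ('p kpgen list \<Rightarrow> 'r::comm_ring_1) set \<Rightarrow> ('p kpgen list \<Rightarrow> 'r) set \<Rightarrow> ('p kpgen list \<Rightarrow> 'r) set" where
  "kp_add K k X Y = kp_cls K k (\<lambda>w. kp_rep X w + kp_rep Y w)"

definition kp_smult :: "'p kgraph \<Rightarrow> nat \<Rightarrow> 'r::comm_ring_1 \<Rightarrow> ('p kpgen list \<Rightarrow> 'r) set \<Rightarrow> ('p kpgen list \<Rightarrow> 'r) set" where
  "kp_smult K k c X = kp_cls K k (\<lambda>w. c * kp_rep X w)"

definition kp_zero :: "'p kgraph \<Rightarrow> nat \<Rightarrow> ('p kpgen list \<Rightarrow> 'r::comm_ring_1) set" where
  "kp_zero K k = kp_cls K k (\<lambda>_. 0)"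

definition kp_s :: "'p kgraph \<Rightarrow> nat \<Rightarrow> 'p \<Rightarrow> ('p kpgen list \<Rightarrow> 'r::comm_ring_1) set" where
  "kp_s K k l = kp_cls K k (fX K l)"

definition kp_sst :: "'p kgraph \<Rightarrow> nat \<Rightarrow> 'p \<Rightarrow> ('p kpgen list \<Rightarrow> 'r::comm_ring_1) set" where
  "kp_sst K k l = kp_cls K k (fY K l)"

inductive_set kp_subalg_gen :: "'p kgraph \<Rightarrow> nat \<Rightarrow> ('p kpgen list \<Rightarrow> 'r::comm_ring_1) set set
    \<Rightarrow> ('p kpgen list \<Rightarrow> 'r) set set"
  for K k S where
  gen: "x \<in> S \<Longrightarrow> x \<in> kp_subalg_gen K k S"
| zero: "kp_zero K k \<in> kp_subalg_gen K k S"
| add: "x \<in> kp_subalg_gen K k S \<Longrightarrow> y \<in> kp_subalg_gen K k S \<Longrightarrow> kp_add K k x y \<in> kp_subalg_gen K k S"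
| mult: "x \<in> kp_subalg_gen K k S \<Longrightarrow> y \<in> kp_subalg_gen K k S \<Longrightarrow> kp_mult K k x y \<in> kp_subalg_gen K k S"
| smult: "x \<in> kp_subalg_gen K k S \<Longrightarrow> kp_smult K k c x \<in> kp_subalg_gen K k S"

definition is_kp_subalg :: "'p kgraph \<Rightarrow> nat \<Rightarrow> ('p kpgen list \<Rightarrow> 'r::comm_ring_1) set set \<Rightarrow> bool" where
  "is_kp_subalg K k B \<longleftrightarrow> B \<subseteq> KP K k \<and> kp_zero K k \<in> B \<and>
     (\<forall>x\<in>B. \<forall>y\<in>B. kp_add K k x y \<in> B \<and> kp_mult K k x y \<in> B) \<and>
     (\<forall>c. \<forall>x\<in>B. kp_smult K k c x \<in> B)"

definition kp_commutative :: "'p kgraph \<Rightarrow> nat \<Rightarrow> ('p kpgen list \<Rightarrow> 'r::comm_ring_1) set set \<Rightarrow> bool" where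
  "kp_commutative K k B \<longleftrightarrow> (\<forall>x\<in>B. \<forall>y\<in>B. kp_mult K k x y = kp_mult K k y x)"

definition kp_D :: "'p kgraph \<Rightarrow> nat \<Rightarrow> ('p kpgen list \<Rightarrow> 'r::comm_ring_1) set set" where
  "kp_D K k = kp_subalg_gen K k {kp_mult K k (kp_s K k m) (kp_sst K k m) | m. m \<in> kg_mor K}"

definition kp_D_commutant :: "'p kgraph \<Rightarrow> nat \<Rightarrow> ('p kpgen list \<Rightarrow> 'r::comm_ring_1) set set" where
  "kp_D_commutant K k = {a \<in> KP K k. \<forall>d \<in> kp_D K k. kp_mult K k a d = kp_mult K k d a}"

definition cycline_pair :: "'p kgraph \<Rightarrow> nat \<Rightarrow> 'r::comm_ring_1 itself \<Rightarrow> 'p \<Rightarrow> 'p \<Rightarrow> bool" where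
  "cycline_pair K k (R :: 'r itself) a b \<longleftrightarrow>
     a \<in> kg_mor K \<and> b \<in> kg_mor K \<and> kg_s K a = kg_s K b \<and>
     (\<forall>g\<in>kg_mor K. kg_r K g = kg_s K a \<longrightarrow>
        kp_mult K k (kp_s K k (kg_comp K a g)) (kp_sst K k (kg_comp K a g))
          = (kp_mult K k (kp_s K k (kg_comp K b g)) (kp_sst K k (kg_comp K b g))
               :: ('p kpgen list \<Rightarrow> 'r) set))"

definition kp_M :: "'p kgraph \<Rightarrow> nat \<Rightarrow> ('p kpgen list \<Rightarrow> 'r::comm_ring_1) set set" where
  "kp_M K k = kp_subalg_gen K k
     {kp_mult K k (kp_s K k a) (kp_sst K k b) | a b. cycline_pair K k TYPE('r) a b}"

end

theory Submission
  imports Defs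
begin

text \<open>The algebra acts on the functions of pairs \<open>(x, n)\<close> with \<open>x\<close> an infinite path and
\<open>n \<in> Z\<^sup>k\<close>: \<open>s_l\<close> removes the initial segment \<open>l\<close> and \<open>s_l*\<close> prepends it, shifting \<open>n\<close> by the
degree. Every element is a finite combination of \<open>s_a s_b*\<close> with all \<open>b\<close> of one common degree, and
the coefficient of \<open>s_a s_b*\<close> is the matrix entry at \<open>a x\<close>, \<open>b x\<close> for any \<open>x\<close> with range \<open>s(a)\<close>.
So the representation is faithful, and everything can be checked on infinite paths. There \<open>(a, b)\<close>
is cycline iff \<open>a x = b x\<close> for all \<open>x\<close>; hence \<open>s_a s_b*\<close> fixes infinite paths and only shifts
degrees, which makes \<open>M\<close> commutative. Conversely, if \<open>a x \<noteq> b x\<close>, a finite path \<open>m\<close> that is an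
initial segment of exactly one of them yields an element \<open>s_m s_m*\<close> of \<open>D\<close> which separates them, so
an element commuting with \<open>D\<close> has coefficient 0 at \<open>s_a s_b*\<close>.\<close>

section \<open>The free algebra\<close>

definition monom :: "'g list \<Rightarrow> 'g list \<Rightarrow> 'r::comm_ring_1" where
  "monom u = (\<lambda>w. if w = u then 1 else 0)"

text \<open>A splitting of \<open>w\<close> is determined by the length of its first part.
  Finiteness makes the sum that defines \<open>fa_mult\<close> a genuine one, since a sum over an
  infinite set would be 0 by convention.\<close>

lemma finite_splits: "finite {p. fst p @ snd p = w}"
proof -
  have "{p. fst p @ snd p = w} \<subseteq> (\<lambda>i. (take i w, drop i w)) ` {..length w}"
  proof
    fix p assume "p \<in> {p. fst p @ snd p = w}"
    then have "p = (take (length (fst p)) w, drop (length (fst p)) w)" "length (fst p) \<le> length w"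
      by (auto simp: prod_eq_iff)
    then show "p \<in> (\<lambda>i. (take i w, drop i w)) ` {..length w}" by blast
  qed
  then show ?thesis by (rule finite_subset) auto
qed

lemma fa_mult_sum_right:
  "fa_mult f (\<lambda>w. \<Sum>i\<in>A. c i * g i w) = (\<lambda>w. \<Sum>i\<in>A. c i * fa_mult f (g i) w)"
proof
  fix w
  show "fa_mult f (\<lambda>w. \<Sum>i\<in>A. c i * g i w) w = (\<Sum>i\<in>A. c i * fa_mult f (g i) w)"
    unfolding fa_mult_def sum_distrib_left
    by (subst sum.swap) (simp add: ac_simps)
qed

lemma fa_mult_sum_left:
  "fa_mult (\<lambda>w. \<Sum>i\<in>A. c i * f i w) g = (\<lambda>w. \<Sum>i\<in>A. c i * fa_mult (f i) g w)"
proof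
  fix w
  show "fa_mult (\<lambda>w. \<Sum>i\<in>A. c i * f i w) g w = (\<Sum>i\<in>A. c i * fa_mult (f i) g w)"
    unfolding fa_mult_def sum_distrib_left sum_distrib_right
    by (subst sum.swap) (simp add: ac_simps)
qed

lemma fa_mult_diff_right:
  "fa_mult f (\<lambda>w. g w - h w) = (\<lambda>w. fa_mult f g w - fa_mult f h w)"
  by (simp add: fa_mult_def right_diff_distrib sum_subtractf)

lemma fa_mult_diff_left:
  "fa_mult (\<lambda>w. g w - h w) f = (\<lambda>w. fa_mult g f w - fa_mult h f w)"
  by (simp add: fa_mult_def left_diff_distrib sum_subtractf)

text \<open>The carrier contains the multiples of the empty word. Through them the ideal, whose
  rules speak only of sums and products, becomes closed under scalars and hence under
  negation.\<close>

lemma fa_mult_const: "fa_mult (\<lambda>w. if w = [] then c else 0) x = (\<lambda>w. c * x w)"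
proof
  fix w
  have "fa_mult (\<lambda>w. if w = [] then c else 0) x w =
     (\<Sum>p\<in>{p. fst p @ snd p = w}. if p = ([], w) then c * x w else 0)"
    unfolding fa_mult_def by (rule sum.cong) auto
  also have "\<dots> = c * x w" using finite_splits[of w] by (subst sum.delta) auto
  finally show "fa_mult (\<lambda>w. if w = [] then c else 0) x w = c * x w" .
qed

lemma fa_mult_monom: "fa_mult (monom u) (monom v) = monom (u @ v)"
proof
  fix w
  have "fa_mult (monom u) (monom v) w =
     (\<Sum>p\<in>{p. fst p @ snd p = w}. if p = (u, v) then 1 else 0)"
    unfolding fa_mult_def monom_def by (rule sum.cong) auto
  also have "\<dots> = (monom (u @ v) w)" unfolding monom_def
    using finite_splits[of w] by (subst sum.delta) auto
  finally show "fa_mult (monom u) (monom v) w = monom (u @ v) w" .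
qed

lemma fa_gen_eq_monom: "fa_gen x = monom [x]"
  by (simp add: fa_gen_def monom_def fun_eq_iff)

lemma fa_mult_zero [simp]: "fa_mult (\<lambda>_. 0) x = (\<lambda>_. 0)" "fa_mult x (\<lambda>_. 0) = (\<lambda>_. 0)"
  by (simp_all add: fa_mult_def)

lemma fa_mult_Nil: "fa_mult f g [] = f [] * g ([] :: 'g list)"
proof -
  have eq: "{p. fst p @ snd p = []} = {([], [] :: 'g list)}" by (auto simp: prod_eq_iff)
  show ?thesis unfolding fa_mult_def eq by simp
qed

lemma fa_mult_nonzero:
  assumes "fa_mult f g w \<noteq> 0"
  obtains u v where "w = u @ v" "f u \<noteq> 0" "g v \<noteq> 0"
proof -
  from assms obtain p where "p \<in> {p. fst p @ snd p = w}" "f (fst p) * g (snd p) \<noteq> 0"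
    unfolding fa_mult_def by (rule sum.not_neutral_contains_not_neutral)
  then show ?thesis using that[of "fst p" "snd p"] by fastforce
qed

lemma fa_mult_support:
  "{w. fa_mult f g w \<noteq> 0} \<subseteq> (\<lambda>p. fst p @ snd p) ` ({w. f w \<noteq> 0} \<times> {w. g w \<noteq> 0})"
proof
  fix w assume "w \<in> {w. fa_mult f g w \<noteq> 0}"
  then obtain u v where "w = u @ v" "f u \<noteq> 0" "g v \<noteq> 0" by (auto elim: fa_mult_nonzero)
  then show "w \<in> (\<lambda>p. fst p @ snd p) ` ({w. f w \<noteq> 0} \<times> {w. g w \<noteq> 0})"
    by (intro image_eqI[of _ _ "(u, v)"]) auto
qed

lemma fa_mult_finite_support:
  "finite {w. f w \<noteq> 0} \<Longrightarrow> finite {w. g w \<noteq> 0} \<Longrightarrow> finite {w. fa_mult f g w \<noteq> 0}"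
  by (rule finite_subset[OF fa_mult_support]) auto

lemma fa_mult_carrier:
  assumes "f \<in> fa_carrier G" "g \<in> fa_carrier G"
  shows "fa_mult f g \<in> fa_carrier G"
  using assms fa_mult_finite_support[of f g]
  by (fastforce simp: fa_carrier_def elim: fa_mult_nonzero)

lemma monom_carrier: "set u \<subseteq> G \<Longrightarrow> monom u \<in> fa_carrier G"
  by (auto simp: fa_carrier_def monom_def)

lemma zero_carrier: "(\<lambda>_. 0) \<in> fa_carrier G"
  by (simp add: fa_carrier_def)

lemma const_carrier: "(\<lambda>w. if w = [] then c else 0) \<in> fa_carrier G"
  by (auto simp: fa_carrier_def)

lemma add_carrier:
  assumes "f \<in> fa_carrier G" "g \<in> fa_carrier G"
  shows "(\<lambda>w. f w + g w) \<in> fa_carrier G"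
proof -
  have "{w. f w + g w \<noteq> 0} \<subseteq> {w. f w \<noteq> 0} \<union> {w. g w \<noteq> 0}" by auto
  then have "finite {w. f w + g w \<noteq> 0}"
    by (rule finite_subset) (use assms in \<open>auto simp: fa_carrier_def\<close>)
  moreover have "f w \<noteq> 0 \<or> g w \<noteq> 0" if "f w + g w \<noteq> 0" for w using that by auto
  ultimately show ?thesis using assms unfolding fa_carrier_def by blast
qed

lemma smult_carrier: "f \<in> fa_carrier G \<Longrightarrow> (\<lambda>w. c * f w) \<in> fa_carrier G"
  using fa_mult_carrier[OF const_carrier[of c G], of f] by (simp add: fa_mult_const)

lemma diff_carrier:
  assumes "f \<in> fa_carrier G" "g \<in> fa_carrier G"
  shows "(\<lambda>w. f w - g w) \<in> fa_carrier G"
  using add_carrier[OF assms(1) smult_carrier[OF assms(2), of "-1"]] by simp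

lemma sum_carrier:
  "(\<And>i. i \<in> A \<Longrightarrow> f i \<in> fa_carrier G) \<Longrightarrow> (\<lambda>w. \<Sum>i\<in>A. f i w) \<in> fa_carrier G"
  by (induction A rule: infinite_finite_induct) (auto intro: zero_carrier add_carrier)

lemma expand_monom:
  assumes "finite {w. f w \<noteq> 0}"
  shows "f = (\<lambda>z. \<Sum>w | f w \<noteq> 0. f w * monom w z)"
proof
  fix z
  have "(\<Sum>w | f w \<noteq> 0. f w * monom w z) = (\<Sum>w | f w \<noteq> 0. if w = z then f z else 0)"
    by (rule sum.cong) (auto simp: monom_def)
  also have "\<dots> = f z" using assms by (subst sum.delta) auto
  finally show "f z = (\<Sum>w | f w \<noteq> 0. f w * monom w z)" by simp
qed

section \<open>Infinite paths\<close>

locale rf_kgraph =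
  fixes K :: "'p kgraph" and k :: nat
  assumes kg: "is_kgraph K k" and rf: "row_finite_no_sources K k"
begin

section \<open>Paths, degrees and unique factorization\<close>

abbreviation "mor \<equiv> kg_mor K"
abbreviation "obj \<equiv> kg_obj K"
abbreviation "r \<equiv> kg_r K"
abbreviation "s \<equiv> kg_s K"
abbreviation "d \<equiv> kg_d K"
abbreviation comp (infixl \<open>\<odot>\<close> 70) where "l \<odot> m \<equiv> kg_comp K l m"

text \<open>These functions encode the elements of N^k. Statements that ask for a path of given
  degree range over them only, as nonzero values beyond \<open>k\<close> are never attained.\<close>

definition dg :: "(nat \<Rightarrow> nat) \<Rightarrow> bool" where "dg n \<longleftrightarrow> (\<forall>i\<ge>k. n i = 0)"

lemma kg_axioms:
  "obj \<subseteq> mor"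
  "\<forall>l\<in>mor. r l \<in> obj \<and> s l \<in> obj"
  "\<forall>v\<in>obj. r v = v \<and> s v = v"
  "\<forall>l\<in>mor. \<forall>m\<in>mor. s l = r m \<longrightarrow>
     l \<odot> m \<in> mor \<and> r (l \<odot> m) = r l \<and> s (l \<odot> m) = s m"
  "\<forall>l\<in>mor. \<forall>m\<in>mor. \<forall>n\<in>mor. s l = r m \<and> s m = r n \<longrightarrow> l \<odot> m \<odot> n = l \<odot> (m \<odot> n)"
  "\<forall>l\<in>mor. r l \<odot> l = l \<and> l \<odot> s l = l"
  "\<forall>l\<in>mor. \<forall>i\<ge>k. d l i = 0"
  "\<forall>l\<in>mor. \<forall>m\<in>mor. s l = r m \<longrightarrow> d (l \<odot> m) = (\<lambda>i. d l i + d m i)"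
  "\<forall>l\<in>mor. \<forall>m n. d l = (\<lambda>i. m i + n i) \<longrightarrow>
     (\<exists>!p. fst p \<in> mor \<and> snd p \<in> mor \<and> s (fst p) = r (snd p) \<and>
        d (fst p) = m \<and> d (snd p) = n \<and> l = fst p \<odot> snd p)"
  by (insert kg, unfold is_kgraph_def, (elim conjE, assumption)+)

lemma obj_mor: "v \<in> obj \<Longrightarrow> v \<in> mor"
  and r_obj: "l \<in> mor \<Longrightarrow> r l \<in> obj"
  and s_obj: "l \<in> mor \<Longrightarrow> s l \<in> obj"
  and r_vertex: "v \<in> obj \<Longrightarrow> r v = v"
  and s_vertex: "v \<in> obj \<Longrightarrow> s v = v"
  and comp_mor: "l \<in> mor \<Longrightarrow> m \<in> mor \<Longrightarrow> s l = r m \<Longrightarrow> l \<odot> m \<in> mor"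
  and r_comp: "l \<in> mor \<Longrightarrow> m \<in> mor \<Longrightarrow> s l = r m \<Longrightarrow> r (l \<odot> m) = r l"
  and s_comp: "l \<in> mor \<Longrightarrow> m \<in> mor \<Longrightarrow> s l = r m \<Longrightarrow> s (l \<odot> m) = s m"
  and comp_r: "l \<in> mor \<Longrightarrow> r l \<odot> l = l"
  and comp_s: "l \<in> mor \<Longrightarrow> l \<odot> s l = l"
  and dg_d: "l \<in> mor \<Longrightarrow> dg (d l)"
  and d_comp: "l \<in> mor \<Longrightarrow> m \<in> mor \<Longrightarrow> s l = r m \<Longrightarrow> d (l \<odot> m) = (\<lambda>i. d l i + d m i)"
  unfolding dg_def using kg_axioms(1-4,6-8) by simp_all blast

lemma comp_assoc:
  "\<lbrakk>l \<in> mor; m \<in> mor; n \<in> mor; s l = r m; s m = r n\<rbrakk> \<Longrightarrow> l \<odot> m \<odot> n = l \<odot> (m \<odot> n)"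
  using kg_axioms(5) by simp

lemmas path_simps [simp] = obj_mor r_obj s_obj r_vertex s_vertex comp_mor r_comp s_comp comp_r comp_s
  d_comp dg_d

lemma factor_ex:
  assumes "l \<in> mor" "\<And>i. m i \<le> d l i"
  obtains a b where "a \<in> mor" "b \<in> mor" "s a = r b" "d a = m" "l = a \<odot> b"
proof -
  have "d l = (\<lambda>i. m i + (d l i - m i))" using assms(2) by (simp add: fun_eq_iff)
  with assms(1) kg_axioms(9) have "\<exists>!p. fst p \<in> mor \<and> snd p \<in> mor \<and> s (fst p) = r (snd p) \<and>
      d (fst p) = m \<and> d (snd p) = (\<lambda>i. d l i - m i) \<and> l = fst p \<odot> snd p" by simp
  then show ?thesis using that by blast
qed

text \<open>The axiom prescribes both degrees. Here the degrees of the second factors agree by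
  cancellation in N^k, so it is enough to compare the first ones.\<close>

lemma factor_unique:
  assumes "a \<in> mor" "b \<in> mor" "s a = r b" "a' \<in> mor" "b' \<in> mor" "s a' = r b'"
    and "a \<odot> b = a' \<odot> b'" "d a = d a'"
  shows "a = a'" "b = b'"
proof -
  have "(\<lambda>i. d a i + d b i) = (\<lambda>i. d a' i + d b' i)"
    using d_comp[OF assms(1-3)] d_comp[OF assms(4-6)] assms(7) by (simp only:)
  then have "d b i = d b' i" for i using fun_cong[of _ _ i] assms(8) by fastforce
  then have db: "d b = d b'" by blast
  have "a \<odot> b \<in> mor" "d (a \<odot> b) = (\<lambda>i. d a i + d b i)"
    using comp_mor[OF assms(1-3)] d_comp[OF assms(1-3)] by auto
  with kg_axioms(9) have "\<exists>!p. fst p \<in> mor \<and> snd p \<in> mor \<and> s (fst p) = r (snd p) \<and>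
      d (fst p) = d a \<and> d (snd p) = d b \<and> a \<odot> b = fst p \<odot> snd p" by simp
  then have "(a, b) = (a', b')" using assms db by (elim ex1E) (metis fst_conv snd_conv)
  then show "a = a'" "b = b'" by simp_all
qed

text \<open>A vertex satisfies \<open>v = v v\<close>, so its degree equals its own double.\<close>

lemma d_vertex [simp]: "v \<in> obj \<Longrightarrow> d v = (\<lambda>_. 0)"
  using d_comp[of v v] comp_r[of v] r_vertex[of v] s_vertex[of v] obj_mor[of v]
  by (metis (no_types, lifting) add_cancel_right_right ext)

text \<open>If \<open>l\<close> has degree 0, then \<open>r l\<close> followed by \<open>l\<close>,
  and \<open>l\<close> followed by \<open>s l\<close>, are two factorizations of \<open>l\<close>
  whose first factors both have degree 0. Hence \<open>r l = l\<close>.\<close>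

lemma d_zero_vertex:
  assumes "l \<in> mor" "d l = (\<lambda>_. 0)"
  shows "l \<in> obj"
proof -
  have "r l = l" using factor_unique(1)[of "r l" l l "s l"] assms by simp
  then show ?thesis using r_obj[OF assms(1)] by simp
qed

section \<open>Initial segments of finite and of infinite paths\<close>

definition pre :: "'p \<Rightarrow> 'p \<Rightarrow> bool" (infix \<open>\<preceq>\<close> 50) where
  "a \<preceq> l \<longleftrightarrow> a \<in> mor \<and> (\<exists>b\<in>mor. s a = r b \<and> l = a \<odot> b)"

lemma preI: "a \<in> mor \<Longrightarrow> b \<in> mor \<Longrightarrow> s a = r b \<Longrightarrow> a \<preceq> a \<odot> b"
  by (auto simp: pre_def)

lemma preE:
  assumes "a \<preceq> l" obtains b where "a \<in> mor" "b \<in> mor" "s a = r b" "l = a \<odot> b"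
  using assms by (auto simp: pre_def)

lemma pre_refl: "a \<in> mor \<Longrightarrow> a \<preceq> a"
  using preI[of a "s a"] by simp

lemma pre_trans: "a \<preceq> b \<Longrightarrow> b \<preceq> c \<Longrightarrow> a \<preceq> c"
  by (auto elim!: preE intro!: preI simp: comp_assoc)

lemma pre_mor: "a \<preceq> l \<Longrightarrow> a \<in> mor" "a \<preceq> l \<Longrightarrow> l \<in> mor"
  by (auto elim!: preE)

lemma pre_r: "a \<preceq> l \<Longrightarrow> r a = r l"
  by (auto elim!: preE)

lemma pre_comp: "a \<in> mor \<Longrightarrow> s a = r b \<Longrightarrow> b \<preceq> c \<Longrightarrow> a \<odot> b \<preceq> a \<odot> c"
  by (elim preE) (auto simp: comp_assoc[symmetric] intro!: preI)

lemma pre_unique: "a \<preceq> l \<Longrightarrow> b \<preceq> l \<Longrightarrow> d a = d b \<Longrightarrow> a = b"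
  by (elim preE) (metis factor_unique(1))

lemma pre_ex:
  assumes "l \<in> mor" "\<And>i. m i \<le> d l i"
  obtains a where "a \<preceq> l" "d a = m"
  using factor_ex[OF assms] preI by metis

text \<open>An infinite path is represented by the set of its finite initial segments.\<close>

definition ipath :: "'p set \<Rightarrow> bool" where
  "ipath X \<longleftrightarrow> X \<subseteq> mor \<and> (\<forall>n. dg n \<longrightarrow> (\<exists>l\<in>X. d l = n)) \<and>
     (\<forall>l\<in>X. \<forall>m\<in>X. d l = d m \<longrightarrow> l = m) \<and> (\<forall>l\<in>X. \<forall>a. a \<preceq> l \<longrightarrow> a \<in> X)"

lemma ipath_mor: "ipath X \<Longrightarrow> l \<in> X \<Longrightarrow> l \<in> mor"
  and ipath_ex: "ipath X \<Longrightarrow> dg n \<Longrightarrow> \<exists>l\<in>X. d l = n"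
  and ipath_unique: "ipath X \<Longrightarrow> l \<in> X \<Longrightarrow> m \<in> X \<Longrightarrow> d l = d m \<Longrightarrow> l = m"
  and ipath_pre: "ipath X \<Longrightarrow> l \<in> X \<Longrightarrow> a \<preceq> l \<Longrightarrow> a \<in> X"
  unfolding ipath_def by blast+

lemma ipath_r: "ipath X \<Longrightarrow> l \<in> X \<Longrightarrow> r l \<in> X"
  using ipath_pre[of X l "r l"] preI[of "r l" l] ipath_mor[of X l] by simp

lemma ipath_vertex_r: "ipath X \<Longrightarrow> v \<in> obj \<Longrightarrow> v \<in> X \<Longrightarrow> l \<in> X \<Longrightarrow> r l = v"
  using ipath_unique[of X "r l" v] ipath_r[of X l] ipath_mor[of X l] by simp

text \<open>The initial segment of \<open>m\<close> of degree \<open>d l\<close> also lies in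
  \<open>X\<close>, which has only one path of that degree.\<close>

lemma ipath_le:
  assumes "ipath X" "l \<in> X" "m \<in> X" "\<And>i. d l i \<le> d m i"
  shows "l \<preceq> m"
proof -
  obtain a where a: "a \<preceq> m" "d a = d l" using pre_ex[of m "d l"] assms ipath_mor by metis
  then have "a = l" using ipath_unique ipath_pre assms by metis
  then show ?thesis using a by simp
qed

lemma ipath_directed:
  assumes "ipath X" "l \<in> X" "m \<in> X"
  obtains n where "n \<in> X" "l \<preceq> n" "m \<preceq> n"
proof -
  have "dg (\<lambda>i. d l i + d m i)"
    using dg_d[of l] dg_d[of m] ipath_mor[OF assms(1)] assms by (simp add: dg_def)
  then obtain n where "n \<in> X" "d n = (\<lambda>i. d l i + d m i)" using ipath_ex assms by metis
  then show ?thesis using that[of n] ipath_le[OF assms(1,2), of n] ipath_le[OF assms(1,3), of n]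
    by simp
qed

text \<open>Both sets have exactly one path in each degree, so neither can be properly contained in
  the other. Every later equality of infinite paths needs only one inclusion for this
  reason.\<close>

lemma ipath_subset_eq: "ipath X \<Longrightarrow> ipath Y \<Longrightarrow> X \<subseteq> Y \<Longrightarrow> X = Y"
proof
  assume X: "ipath X" and Y: "ipath Y" and sub: "X \<subseteq> Y"
  show "Y \<subseteq> X"
  proof
    fix l assume l: "l \<in> Y"
    obtain m where "m \<in> X" "d m = d l" using ipath_ex[OF X dg_d[OF ipath_mor[OF Y l]]] by blast
    then have "m = l" using ipath_unique[OF Y, of m l] sub l by blast
    then show "l \<in> X" using \<open>m \<in> X\<close> by simp
  qed
qed

section \<open>Prepending a finite path to an infinite one, and removing it\<close>

definition ext :: "'p \<Rightarrow> 'p set \<Rightarrow> 'p set" where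
  "ext l X = {m. \<exists>n\<in>X. m \<preceq> l \<odot> n}"

definition sub :: "'p \<Rightarrow> 'p set \<Rightarrow> 'p set" where
  "sub l X = {n\<in>mor. s l = r n \<and> l \<odot> n \<in> X}"

lemma ipath_sub:
  assumes X: "ipath X" and l: "l \<in> X"
  shows "ipath (sub l X)"
  unfolding ipath_def
proof (intro conjI allI impI ballI)
  have lm: "l \<in> mor" using ipath_mor X l .
  show "sub l X \<subseteq> mor" by (auto simp: sub_def)
  fix n assume n: "dg n"
  have "dg (\<lambda>i. d l i + n i)" using n dg_d[OF lm] by (simp add: dg_def)
  then obtain m where m: "m \<in> X" "d m = (\<lambda>i. d l i + n i)" using ipath_ex[OF X] by blast
  have "l \<preceq> m" using ipath_le[OF X l m(1)] m by simp
  then obtain b where b: "b \<in> mor" "s l = r b" "m = l \<odot> b" by (elim preE)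
  then have "d b = n" using m lm by (simp add: fun_eq_iff)
  then show "\<exists>b\<in>sub l X. d b = n" using b m by (auto simp: sub_def)
next
  have lm: "l \<in> mor" using ipath_mor X l .
  fix m n assume *: "m \<in> sub l X" "n \<in> sub l X" "d m = d n"
  then have "l \<odot> m = l \<odot> n" using lm by (intro ipath_unique[OF X]) (auto simp: sub_def)
  then show "m = n" using * lm factor_unique(2)[of l m l n] by (auto simp: sub_def)
next
  have lm: "l \<in> mor" using ipath_mor X l .
  fix m a assume *: "m \<in> sub l X" "a \<preceq> m"
  then have "s l = r a" using pre_r by (auto simp: sub_def)
  then show "a \<in> sub l X"
    using * pre_comp[OF lm, of a m] ipath_pre[OF X] by (auto simp: sub_def pre_mor)
qed

lemma ext_r:
  assumes "ipath X" "l \<in> mor" "s l \<in> X" "n \<in> X"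
  shows "s l = r n"
  using ipath_vertex_r[of X "s l" n] assms by simp

text \<open>The paths \<open>l n\<close> with \<open>n\<close> in \<open>X\<close> only have degrees
  above \<open>d l\<close>; the other degrees occur because \<open>ext\<close> contains all initial
  segments of these paths.\<close>

lemma ipath_ext:
  assumes X: "ipath X" and l: "l \<in> mor" "s l \<in> X"
  shows "ipath (ext l X)"
  unfolding ipath_def
proof (intro conjI allI impI ballI)
  show "ext l X \<subseteq> mor" by (auto simp: ext_def pre_mor)
  fix n assume "dg n"
  then obtain m where m: "m \<in> X" "d m = n" using ipath_ex[OF X] by blast
  then have "m \<in> mor" "s l = r m" using ipath_mor[OF X] ext_r X l by auto
  then obtain a where "a \<preceq> l \<odot> m" "d a = n"
    using pre_ex[of "l \<odot> m" n] l m by auto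
  then show "\<exists>a\<in>ext l X. d a = n" using m by (auto simp: ext_def)
next
  fix a b assume "a \<in> ext l X" "b \<in> ext l X" and ab: "d a = d b"
  then obtain m n where mn: "m \<in> X" "n \<in> X" "a \<preceq> l \<odot> m" "b \<preceq> l \<odot> n" by (auto simp: ext_def)
  \<comment> \<open>Directedness places \<open>a\<close> and \<open>b\<close> inside one finite
    path, where unique factorization can compare them.\<close>
  obtain t where t: "t \<in> X" "m \<preceq> t" "n \<preceq> t" using ipath_directed[OF X mn(1,2)] .
  have "a \<preceq> l \<odot> t" "b \<preceq> l \<odot> t"
    using pre_trans[OF mn(3) pre_comp[OF l(1) ext_r[OF X l mn(1)] t(2)]]
      pre_trans[OF mn(4) pre_comp[OF l(1) ext_r[OF X l mn(2)] t(3)]] .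
  then show "a = b" using pre_unique ab by blast
next
  fix m a assume "m \<in> ext l X" "a \<preceq> m"
  then show "a \<in> ext l X" using pre_trans by (auto simp: ext_def)
qed

lemma in_ext: "ipath X \<Longrightarrow> l \<in> mor \<Longrightarrow> s l \<in> X \<Longrightarrow> n \<in> X \<Longrightarrow> l \<odot> n \<in> ext l X"
  using ext_r[of X l n] ipath_mor[of X n] by (auto simp: ext_def intro!: bexI[of _ n] pre_refl)

lemma ext_self: "ipath X \<Longrightarrow> l \<in> mor \<Longrightarrow> s l \<in> X \<Longrightarrow> l \<in> ext l X"
  using in_ext[of X l "s l"] by simp

lemma s_in_sub: "ipath X \<Longrightarrow> l \<in> X \<Longrightarrow> s l \<in> sub l X"
  using ipath_mor[of X l] by (simp add: sub_def)

lemma sub_ext: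
  assumes "ipath X" "l \<in> mor" "s l \<in> X"
  shows "sub l (ext l X) = X"
proof -
  have "X \<subseteq> sub l (ext l X)"
    using assms in_ext ext_r ipath_mor by (auto simp: sub_def)
  then show ?thesis
    using ipath_subset_eq[OF assms(1) ipath_sub[OF ipath_ext[OF assms] ext_self[OF assms]]] by simp
qed

lemma ext_sub:
  assumes "ipath X" "l \<in> X"
  shows "ext l (sub l X) = X"
proof -
  have "ext l (sub l X) \<subseteq> X" using assms ipath_pre by (auto simp: ext_def sub_def)
  then show ?thesis
    using ipath_subset_eq[OF ipath_ext[OF ipath_sub[OF assms] _ s_in_sub[OF assms]] assms(1)]
      ipath_mor assms by simp
qed

lemma comp_in_iff:
  assumes "ipath X" "l \<in> mor" "m \<in> mor" "s l = r m"
  shows "l \<odot> m \<in> X \<longleftrightarrow> l \<in> X \<and> m \<in> sub l X"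
  using assms ipath_pre[of X "l \<odot> m" l] preI[of l m] by (auto simp: sub_def)

lemma sub_comp:
  assumes "ipath X" "l \<in> mor" "m \<in> mor" "s l = r m"
  shows "sub (l \<odot> m) X = sub m (sub l X)"
proof -
  have "n \<in> sub (l \<odot> m) X \<longleftrightarrow> n \<in> sub m (sub l X)" for n
  proof (cases "n \<in> mor \<and> s m = r n")
    case True
    then have "l \<odot> m \<odot> n = l \<odot> (m \<odot> n)" "m \<odot> n \<in> mor" "r (m \<odot> n) = r m"
      "s (l \<odot> m) = s m"
      using assms(2-4) comp_assoc comp_mor r_comp s_comp by auto
    then show ?thesis using True assms(4) unfolding sub_def by force
  next
    case False
    then show ?thesis using s_comp[OF assms(2-4)] by (auto simp only: sub_def mem_Collect_eq)
  qed
  then show ?thesis by blast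
qed

lemma ext_comp_vertex:
  assumes X: "ipath X" and l: "l \<in> mor" "m \<in> mor" "s l = r m" "s m \<in> X"
  shows "s l \<in> ext m X"
  using ipath_r[OF ipath_ext[OF X l(2,4)] ext_self[OF X l(2,4)]] l by simp

lemma ext_comp:
  assumes X: "ipath X" and l: "l \<in> mor" "m \<in> mor" "s l = r m" "s m \<in> X"
  shows "ext (l \<odot> m) X = ext l (ext m X)"
proof -
  have v: "s l \<in> ext m X" using ext_comp_vertex[OF assms] .
  have Y: "ipath (ext m X)" using ipath_ext X l by blast
  have sub: "ext (l \<odot> m) X \<subseteq> ext l (ext m X)"
  proof
    fix a assume "a \<in> ext (l \<odot> m) X"
    then obtain n where n: "n \<in> X" "a \<preceq> l \<odot> m \<odot> n" by (auto simp: ext_def)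
    have "s m = r n" "n \<in> mor" using ext_r X l n ipath_mor by auto
    then have "a \<preceq> l \<odot> (m \<odot> n)" using n l by (simp add: comp_assoc)
    then show "a \<in> ext l (ext m X)" using in_ext[OF X l(2,4) n(1)] by (auto simp: ext_def)
  qed
  show ?thesis
    by (rule ipath_subset_eq[OF _ _ sub]) (use ipath_ext X Y l v in auto)
qed

lemma sub_vertex:
  assumes "ipath X" "v \<in> obj" "v \<in> X"
  shows "sub v X = X"
proof -
  have "X \<subseteq> sub v X"
  proof
    fix n assume "n \<in> X"
    then have "n \<in> mor" "r n = v" using assms ipath_mor ipath_vertex_r by auto
    then show "n \<in> sub v X" using \<open>n \<in> X\<close> assms comp_r[of n] by (auto simp: sub_def)
  qed
  then show ?thesis using ipath_subset_eq[OF assms(1) ipath_sub[OF assms(1,3)]] by simp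
qed

lemma ext_vertex: "ipath X \<Longrightarrow> v \<in> obj \<Longrightarrow> v \<in> X \<Longrightarrow> ext v X = X"
  using ext_sub[of X v] sub_vertex[of X v] by simp

text \<open>The infinite path \<open>l X\<close> has a single initial segment of degree
  \<open>d l\<close>. This is what makes (KP3) hold in the representation.\<close>

lemma ext_s_in: "ipath X \<Longrightarrow> l \<in> mor \<Longrightarrow> m \<in> mor \<Longrightarrow> s l \<in> X \<Longrightarrow> d l = d m \<Longrightarrow> m \<in> ext l X \<longleftrightarrow> m = l"
  using ipath_unique[OF ipath_ext, of X l m l] ext_self[of X l] by auto

lemma finite_paths: "v \<in> obj \<Longrightarrow> dg n \<Longrightarrow> finite {l\<in>mor. r l = v \<and> d l = n}"
  and paths_nonempty: "v \<in> obj \<Longrightarrow> dg n \<Longrightarrow> \<exists>l\<in>mor. r l = v \<and> d l = n"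
  using rf unfolding row_finite_no_sources_def dg_def by blast+

text \<open>Starting at \<open>v\<close>, paths of degree (1,...,1) are appended forever, which is
  possible because there are no sources. The multiples of (1,...,1) are cofinal in N^k, so the
  initial segments of these finite paths form an infinite path.\<close>

lemma ipath_exists:
  assumes v: "v \<in> obj"
  shows "\<exists>X. ipath X \<and> v \<in> X"
proof -
  define one where "one = (\<lambda>i. if i < k then 1 else 0 :: nat)"
  have "dg one" by (simp add: one_def dg_def)
  then have "\<forall>l\<in>mor. \<exists>m. m \<in> mor \<and> s l = r m \<and> d m = one"
    using paths_nonempty by (metis s_obj)
  then obtain ch where ch: "\<And>l. l \<in> mor \<Longrightarrow> ch l \<in> mor \<and> s l = r (ch l) \<and> d (ch l) = one"
    by metis
  define y where "y = rec_nat v (\<lambda>_ l. l \<odot> ch l)"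
  have y0: "y 0 = v" and yS: "\<And>j. y (Suc j) = y j \<odot> ch (y j)" by (simp_all add: y_def)
  have ym: "y j \<in> mor" for j by (induction j) (use v ch in \<open>auto simp: y0 yS\<close>)
  have yd: "d (y j) = (\<lambda>i. j * one i)" for j
    by (induction j) (use v ch ym in \<open>auto simp: y0 yS fun_eq_iff\<close>)
  have ypre: "y i \<preceq> y (i + j)" for i j
  proof (induction j)
    case 0 then show ?case by (simp add: pre_refl ym)
  next
    case (Suc j)
    have "y (i + j) \<preceq> y (Suc (i + j))" using ch[OF ym] ym by (auto simp: yS intro!: preI)
    then show ?case using pre_trans Suc by simp
  qed
  define X where "X = {a. \<exists>j. a \<preceq> y j}"
  have "ipath X" unfolding ipath_def
  proof (intro conjI allI impI ballI)
    show "X \<subseteq> mor" by (auto simp: X_def pre_mor)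
    fix n assume n: "dg n"
    \<comment> \<open>The sum of all entries of \<open>n\<close> is a number of repetitions that
      dominates each single entry.\<close>
    have "n i \<le> (\<Sum>i<k. n i) * one i" for i
      using n member_le_sum[of i "{..<k}" n] by (auto simp: one_def dg_def)
    then obtain a where "a \<preceq> y (\<Sum>i<k. n i)" "d a = n"
      using pre_ex[OF ym, of n "\<Sum>i<k. n i"] by (auto simp: yd)
    then show "\<exists>a\<in>X. d a = n" by (auto simp: X_def)
  next
    fix a b assume "a \<in> X" "b \<in> X" and ab: "d a = d b"
    then obtain i j where "a \<preceq> y i" "b \<preceq> y j" by (auto simp: X_def)
    then have "a \<preceq> y (i + j)" "b \<preceq> y (i + j)"
      using pre_trans ypre[of i j] ypre[of j i] by (auto simp: add.commute)
    then show "a = b" using pre_unique ab by blast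
  next
    fix l a assume "l \<in> X" "a \<preceq> l"
    then show "a \<in> X" using pre_trans by (auto simp: X_def)
  qed
  moreover have "v \<in> X" using pre_refl[of v] v by (auto simp: X_def y0[symmetric] ym)
  ultimately show ?thesis by blast
qed

section \<open>Normal forms modulo the Kumjian--Pask relations\<close>

abbreviation "gens \<equiv> kp_gens K"
abbreviation "sg \<equiv> sgen K"
abbreviation "st \<equiv> sstgen K"

definition eqv :: "('p kpgen list \<Rightarrow> 'r::comm_ring_1) \<Rightarrow> ('p kpgen list \<Rightarrow> 'r) \<Rightarrow> bool" (infix \<open>\<approx>\<close> 50)
  where "f \<approx> g \<longleftrightarrow> fa_sub f g \<in> kp_ideal K k"

lemma fX_eq: "fX K l = monom [sg l]" and fY_eq: "fY K l = monom [st l]"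
  by (simp_all add: fX_def fY_def fa_gen_eq_monom)

lemma sg_gens [simp]: "l \<in> mor \<Longrightarrow> sg l \<in> gens"
  and st_gens [simp]: "l \<in> mor \<Longrightarrow> st l \<in> gens"
  using d_zero_vertex[of l] by (auto simp: sgen_def sstgen_def kp_gens_def)

lemma st_vertex: "v \<in> obj \<Longrightarrow> st v = sg v"
  by (simp add: sgen_def sstgen_def)

text \<open>Vertices fall under the first case. A starred letter comes in two spellings:
  \<open>Sst l\<close> evaluates \<open>star_deg\<close>, while \<open>st l\<close> matches the
  relations.\<close>

lemma gens_cases:
  assumes "g \<in> gens"
  obtains l where "l \<in> mor" "g = sg l" | l where "l \<in> mor" "g = Sst l" "g = st l"
proof -
  consider v where "v \<in> obj" "g = Pv v" | l where "l \<in> mor" "d l \<noteq> (\<lambda>_. 0)" "g = Sg l"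
    | l where "l \<in> mor" "d l \<noteq> (\<lambda>_. 0)" "g = Sst l"
    using assms unfolding kp_gens_def by blast
  then show thesis
  proof cases
    case (1 v)
    then show thesis using that(1)[of v] by (simp add: sgen_def)
  qed (use that in \<open>auto simp: sgen_def sstgen_def\<close>)
qed

lemma rels_carrier: "x \<in> kp_rels K k \<Longrightarrow> x \<in> fa_carrier gens"
  unfolding kp_rels_def fa_sub_def fX_eq fY_eq
  by (elim UnE CollectE exE conjE;
      auto intro!: diff_carrier fa_mult_carrier monom_carrier sum_carrier zero_carrier)

lemma ideal_carrier: "x \<in> kp_ideal K k \<Longrightarrow> x \<in> fa_carrier gens"
  by (induction rule: kp_ideal.induct)
    (auto intro: rels_carrier zero_carrier add_carrier fa_mult_carrier)

lemma ideal_smult: "x \<in> kp_ideal K k \<Longrightarrow> (\<lambda>w. c * x w) \<in> kp_ideal K k"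
  using kp_ideal.lmult[OF _ const_carrier[of c gens], of x k] by (simp add: fa_mult_const)

lemma eqv_refl: "f \<approx> f"
  by (simp add: eqv_def fa_sub_def kp_ideal.zero)

lemma eqv_sym: "f \<approx> g \<Longrightarrow> g \<approx> f"
  using ideal_smult[of "fa_sub f g" "-1"] by (simp add: eqv_def fa_sub_def)

lemma eqv_trans [trans]: "f \<approx> g \<Longrightarrow> g \<approx> h \<Longrightarrow> f \<approx> h"
  unfolding eqv_def fa_sub_def using kp_ideal.add by fastforce

lemma eqv_add: "f \<approx> g \<Longrightarrow> f' \<approx> g' \<Longrightarrow> (\<lambda>w. f w + f' w) \<approx> (\<lambda>w. g w + g' w)"
  unfolding eqv_def fa_sub_def using kp_ideal.add by (fastforce simp: algebra_simps)

lemma eqv_smult: "f \<approx> g \<Longrightarrow> (\<lambda>w. c * f w) \<approx> (\<lambda>w. c * g w)"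
  unfolding eqv_def fa_sub_def using ideal_smult[of "\<lambda>w. f w - g w" c]
  by (simp add: algebra_simps)

lemma eqv_mult_left: "f \<approx> g \<Longrightarrow> a \<in> fa_carrier gens \<Longrightarrow> fa_mult a f \<approx> fa_mult a g"
  unfolding eqv_def fa_sub_def using kp_ideal.lmult[of "\<lambda>w. f w - g w" K k a]
  by (simp add: fa_mult_diff_right)

lemma eqv_mult_right: "f \<approx> g \<Longrightarrow> a \<in> fa_carrier gens \<Longrightarrow> fa_mult f a \<approx> fa_mult g a"
  unfolding eqv_def fa_sub_def using kp_ideal.rmult[of "\<lambda>w. f w - g w" K k a]
  by (simp add: fa_mult_diff_left)

lemma eqv_context:
  assumes "f \<approx> g" "set u \<subseteq> gens" "set v \<subseteq> gens"
  shows "fa_mult (monom u) (fa_mult f (monom v)) \<approx> fa_mult (monom u) (fa_mult g (monom v))"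
  using assms by (intro eqv_mult_left eqv_mult_right monom_carrier)

lemma eqv_context_monom:
  assumes "monom w \<approx> (monom w' :: 'p kpgen list \<Rightarrow> 'r::comm_ring_1)" "set u \<subseteq> gens" "set v \<subseteq> gens"
  shows "monom (u @ w @ v) \<approx> (monom (u @ w' @ v) :: 'p kpgen list \<Rightarrow> 'r)"
  using eqv_context[OF assms] by (simp add: fa_mult_monom)

lemma eqv_context_zero:
  assumes "monom w \<approx> (\<lambda>_. 0 :: 'r::comm_ring_1)" "set u \<subseteq> gens" "set v \<subseteq> gens"
  shows "monom (u @ w @ v) \<approx> (\<lambda>_. 0 :: 'r)"
  using eqv_context[OF assms] by (simp add: fa_mult_monom)

lemma eqv_context_sum:
  assumes "monom w \<approx> (\<lambda>z. \<Sum>i\<in>A. monom (t i) z :: 'r::comm_ring_1)"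
    and "set u \<subseteq> gens" "set v \<subseteq> gens"
  shows "monom (u @ w @ v) \<approx> (\<lambda>z. \<Sum>i\<in>A. monom (u @ t i @ v) z :: 'r)"
proof -
  have "fa_mult f (\<lambda>z. \<Sum>i\<in>A. g i z) = (\<lambda>z. \<Sum>i\<in>A. fa_mult f (g i) z)"
    "fa_mult (\<lambda>z. \<Sum>i\<in>A. g i z) f = (\<lambda>z. \<Sum>i\<in>A. fa_mult (g i) f z)"
    for f and g :: "_ \<Rightarrow> 'p kpgen list \<Rightarrow> 'r"
    using fa_mult_sum_right[of f "\<lambda>_. 1" g A] fa_mult_sum_left[of "\<lambda>_. 1" g A f] by simp_all
  then show ?thesis using eqv_context[OF assms] by (simp add: fa_mult_monom)
qed

lemma rel_vertices:
  assumes "v \<in> obj" "w \<in> obj" "v \<noteq> w"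
  shows "monom [sg v, sg w] \<approx> (\<lambda>_. 0 :: 'r::comm_ring_1)"
proof -
  have "fa_sub (fa_mult (fX K v) (fX K w)) (if v = w then fX K v else (\<lambda>_. 0 :: 'r)) \<in> kp_rels K k"
    \<comment> \<open>The rules for unions walk to the intended one of the nine families of
      relations; the next lemmas do the same.\<close>
    unfolding kp_rels_def by (rule UnI1, rule UnI1, rule UnI1, rule UnI1, rule UnI1, rule UnI1, rule UnI1, rule UnI1, rule CollectI, intro exI conjI, rule refl) (use assms in simp_all)
  from kp_ideal.base[OF this] show ?thesis using assms by (simp add: eqv_def fX_eq fa_mult_monom)
qed

lemma rel_comp:
  assumes "l \<in> mor" "m \<in> mor" "s l = r m"
  shows "monom [sg l, sg m] \<approx> (monom [sg (l \<odot> m)] :: 'p kpgen list \<Rightarrow> 'r::comm_ring_1)"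
proof -
  have "fa_sub (fa_mult (fX K l) (fX K m)) (fX K (l \<odot> m) :: 'p kpgen list \<Rightarrow> 'r) \<in> kp_rels K k"
    unfolding kp_rels_def by (rule UnI1, rule UnI1, rule UnI1, rule UnI1, rule UnI1, rule UnI1, rule UnI1, rule UnI2, rule CollectI, intro exI conjI, rule refl) (use assms in simp_all)
  from kp_ideal.base[OF this] show ?thesis by (simp add: eqv_def fX_eq fa_mult_monom)
qed

lemma rel_source:
  assumes "l \<in> mor"
  shows "monom [sg l, sg (s l)] \<approx> (monom [sg l] :: 'p kpgen list \<Rightarrow> 'r::comm_ring_1)"
  using rel_comp[of l "s l"] assms by simp

lemma rel_range:
  assumes "l \<in> mor"
  shows "monom [sg (r l), sg l] \<approx> (monom [sg l] :: 'p kpgen list \<Rightarrow> 'r::comm_ring_1)"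
  using rel_comp[of "r l" l] assms by simp

lemma rel_star_range:
  assumes "l \<in> mor"
  shows "monom [st l, sg (r l)] \<approx> (monom [st l] :: 'p kpgen list \<Rightarrow> 'r::comm_ring_1)"
proof -
  have "fa_sub (fa_mult (fY K l) (fX K (r l))) (fY K l :: 'p kpgen list \<Rightarrow> 'r) \<in> kp_rels K k"
    unfolding kp_rels_def by (rule UnI1, rule UnI1, rule UnI2, rule CollectI, intro exI conjI, rule refl) (use assms in simp_all)
  from kp_ideal.base[OF this] show ?thesis by (simp add: eqv_def fX_eq fY_eq fa_mult_monom)
qed

lemma rel_star_path:
  assumes "l \<in> mor" "m \<in> mor" "d l = d m"
  shows "monom [st l, sg m] \<approx> (if l = m then monom [sg (s l)] else (\<lambda>_. 0 :: 'r::comm_ring_1))"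
proof -
  have "fa_sub (fa_mult (fY K l) (fX K m)) (if l = m then fX K (s l) else (\<lambda>_. 0 :: 'r)) \<in> kp_rels K k"
    unfolding kp_rels_def by (rule UnI1, rule UnI2, rule CollectI, intro exI conjI, rule refl) (use assms in simp_all)
  from kp_ideal.base[OF this] show ?thesis
    by (cases "l = m") (simp_all add: eqv_def fX_eq fY_eq fa_mult_monom)
qed

text \<open>This is (KP4) with degree 0 included, where the vertex itself is the only path.
  Expansions can then be made in any degree of N^k.\<close>

lemma rel_vertex_sum:
  assumes "v \<in> obj" "dg n"
  shows "monom [sg v] \<approx> (\<lambda>z. \<Sum>l\<in>{l\<in>mor. r l = v \<and> d l = n}. monom [sg l, st l] z :: 'r::comm_ring_1)"
proof (cases "n = (\<lambda>_. 0)")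
  case True
  have "l = v" if "l \<in> mor" "r l = v" "d l = n" for l
    using r_vertex[OF d_zero_vertex[OF that(1)]] that(2,3) True by simp
  then have "{l\<in>mor. r l = v \<and> d l = n} = {v}"
    using obj_mor[OF assms(1)] r_vertex[OF assms(1)] d_vertex[OF assms(1)] True by blast
  then show ?thesis using eqv_sym[OF rel_source[of v]] assms by (simp add: st_vertex)
next
  case False
  have "fa_sub (fX K v) (\<lambda>w. \<Sum>l\<in>{l\<in>mor. r l = v \<and> d l = n}. fa_mult (fX K l) (fY K l) w :: 'r)
      \<in> kp_rels K k"
    unfolding kp_rels_def by (rule UnI2, rule CollectI, intro exI conjI, rule refl)
      (use assms False in \<open>simp_all add: dg_def\<close>)
  from kp_ideal.base[OF this] show ?thesis by (simp add: eqv_def fX_eq fY_eq fa_mult_monom)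
qed

section \<open>Rewriting words into normal form\<close>

primrec star_deg :: "'p kpgen \<Rightarrow> nat \<Rightarrow> nat" where
  "star_deg (Pv v) = (\<lambda>_. 0)"
| "star_deg (Sg l) = (\<lambda>_. 0)"
| "star_deg (Sst l) = d l"

text \<open>\<open>s_l\<close> either prepends \<open>l\<close> to \<open>a\<close> or meets the
  wrong vertex. \<open>s_l*\<close> is compared by (KP3) with the initial segment of
  \<open>a\<close> of degree \<open>d l\<close>, which exists by the hypothesis on degrees, and
  either cancels it or gives 0. So \<open>star_deg g\<close> bounds the degree that is lost.\<close>

lemma letter_path:
  assumes "g \<in> gens" "a \<in> mor" "\<And>i. star_deg g i \<le> d a i"
  shows "monom [g, sg a] \<approx> (\<lambda>_. 0 :: 'r::comm_ring_1) \<or>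
    (\<exists>b\<in>mor. s b = s a \<and> (\<forall>i. d a i \<le> d b i + star_deg g i) \<and>
       monom [g, sg a] \<approx> (monom [sg b] :: 'p kpgen list \<Rightarrow> 'r))"
  using assms(1)
proof (cases rule: gens_cases)
  case (1 l)
  show ?thesis
  proof (cases "s l = r a")
    case True
    then show ?thesis
      using 1 rel_comp[of l a] assms(2) by (intro disjI2 bexI[of _ "l \<odot> a"]) auto
  next
    case False
    \<comment> \<open>For paths that do not compose, the vertices \<open>s l\<close> and
      \<open>r a\<close> are inserted between them; these are distinct and hence orthogonal.\<close>
    have "monom [sg l, sg a] \<approx> (monom [sg l, sg (s l), sg a] :: 'p kpgen list \<Rightarrow> 'r)"
      using eqv_context_monom[OF eqv_sym[OF rel_source[of l]], of "[]" "[sg a]"] 1 assms(2) by simp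
    also have "monom [sg l, sg (s l), sg a] \<approx> (monom [sg l, sg (s l), sg (r a), sg a] :: 'p kpgen list \<Rightarrow> 'r)"
      using eqv_context_monom[OF eqv_sym[OF rel_range[of a]], of "[sg l, sg (s l)]" "[]"] 1 assms(2) by simp
    also have "monom [sg l, sg (s l), sg (r a), sg a] \<approx> (\<lambda>_. 0 :: 'r)"
      using eqv_context_zero[OF rel_vertices[OF _ _ False], of "[sg l]" "[sg a]"] 1 assms(2) by simp
    finally show ?thesis using 1 by simp
  qed
next
  case (2 l)
  then obtain a' b where ab: "a' \<in> mor" "b \<in> mor" "s a' = r b" "d a' = d l" "a = a' \<odot> b"
    using factor_ex[OF assms(2), of "d l"] assms(3) by auto
  have 3: "monom [g, sg a] \<approx> (monom [st l, sg a', sg b] :: 'p kpgen list \<Rightarrow> 'r)"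
    using eqv_context_monom[OF eqv_sym[OF rel_comp[OF ab(1-3)]], of "[st l]" "[]"]
      st_gens[OF 2(1)] unfolding ab(5) 2(3) by simp
  show ?thesis
  proof (cases "l = a'")
    case True
    have "monom [st l, sg a'] \<approx> (monom [sg (r b)] :: 'p kpgen list \<Rightarrow> 'r)"
      using rel_star_path[OF 2(1) ab(1) ab(4)[symmetric], where ?'r = 'r]
      unfolding True ab(3) by simp
    then have "monom [st l, sg a', sg b] \<approx> (monom [sg (r b), sg b] :: 'p kpgen list \<Rightarrow> 'r)"
      using eqv_context_monom[of "[st l, sg a']" "[sg (r b)]" "[]" "[sg b]"] sg_gens[OF ab(2)]
      by simp
    also have "monom [sg (r b), sg b] \<approx> (monom [sg b] :: 'p kpgen list \<Rightarrow> 'r)"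
      using rel_range[OF ab(2)] .
    finally have "monom [g, sg a] \<approx> (monom [sg b] :: 'p kpgen list \<Rightarrow> 'r)"
      by (rule eqv_trans[OF 3])
    moreover have "s b = s a" unfolding ab(5) using s_comp[OF ab(1-3)] by simp
    moreover have "d a i \<le> d b i + star_deg g i" for i
      unfolding ab(5) d_comp[OF ab(1-3)] using ab(4) 2(2) by simp
    ultimately show ?thesis using ab(2) by blast
  next
    case False
    have "monom [st l, sg a'] \<approx> (\<lambda>_. 0 :: 'r)"
      using rel_star_path[OF 2(1) ab(1) ab(4)[symmetric], where ?'r = 'r] False by simp
    then have "monom [st l, sg a', sg b] \<approx> (\<lambda>_. 0 :: 'r)"
      using eqv_context_zero[of "[st l, sg a']" "[]" "[sg b]"] sg_gens[OF ab(2)] by simp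
    then show ?thesis using eqv_trans[OF 3] by simp
  qed
qed

text \<open>The letters act on \<open>a\<close> one after the other from the right, and
  \<open>N\<close> is the total degree that the starred letters can strip. The slack
  \<open>m\<close> is the degree that has to survive for letters further to the left; the induction
  needs it.\<close>

lemma word_path:
  assumes "set w \<subseteq> gens"
  shows "\<exists>N. dg N \<and> (\<forall>m. \<forall>a\<in>mor. (\<forall>i. N i + m i \<le> d a i) \<longrightarrow>
    monom (w @ [sg a]) \<approx> (\<lambda>_. 0 :: 'r::comm_ring_1) \<or>
    (\<exists>b\<in>mor. s b = s a \<and> (\<forall>i. m i \<le> d b i) \<and>
       monom (w @ [sg a]) \<approx> (monom [sg b] :: 'p kpgen list \<Rightarrow> 'r)))"
  using assms
proof (induction w)
  case Nil
  show ?case by (rule exI[of _ "\<lambda>_. 0"]) (auto simp: dg_def intro: eqv_refl)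
next
  case (Cons g w)
  then obtain N where N: "dg N"
    "\<And>m a. a \<in> mor \<Longrightarrow> (\<forall>i. N i + m i \<le> d a i) \<Longrightarrow>
      monom (w @ [sg a]) \<approx> (\<lambda>_. 0 :: 'r) \<or>
      (\<exists>b\<in>mor. s b = s a \<and> (\<forall>i. m i \<le> d b i) \<and>
         monom (w @ [sg a]) \<approx> (monom [sg b] :: 'p kpgen list \<Rightarrow> 'r))"
    by auto
  have g: "g \<in> gens" and w: "set w \<subseteq> gens" using Cons.prems by auto
  have dgN: "dg (\<lambda>i. N i + star_deg g i)"
    using N(1) g dg_d by (auto simp: kp_gens_def dg_def)
  have "monom ((g # w) @ [sg a]) \<approx> (\<lambda>_. 0 :: 'r) \<or>
      (\<exists>b\<in>mor. s b = s a \<and> (\<forall>i. m i \<le> d b i) \<and>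
         monom ((g # w) @ [sg a]) \<approx> (monom [sg b] :: 'p kpgen list \<Rightarrow> 'r))"
    if a: "a \<in> mor" and le: "\<forall>i. N i + star_deg g i + m i \<le> d a i" for m a
  proof -
    \<comment> \<open>The induction hypothesis is used with the larger slack
      \<open>star_deg g + m\<close>, which leaves room for \<open>g\<close> itself.\<close>
    have "\<forall>i. N i + (star_deg g i + m i) \<le> d a i" using le by (simp add: add.assoc)
    from N(2)[OF a this] show ?thesis
    proof (elim disjE bexE conjE)
      assume z: "monom (w @ [sg a]) \<approx> (\<lambda>_. 0 :: 'r)"
      show ?thesis using eqv_context_zero[OF z, of "[g]" "[]"] g by simp
    next
      fix b assume b: "b \<in> mor" "s b = s a" "\<forall>i. star_deg g i + m i \<le> d b i"
        and wb: "monom (w @ [sg a]) \<approx> (monom [sg b] :: 'p kpgen list \<Rightarrow> 'r)"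
      have gb: "monom ((g # w) @ [sg a]) \<approx> (monom [g, sg b] :: 'p kpgen list \<Rightarrow> 'r)"
        using eqv_context_monom[OF wb, of "[g]" "[]"] g by simp
      have "star_deg g i \<le> d b i" for i using b(3) add_leD1 by blast
      from letter_path[OF g b(1) this, where ?'r = 'r] show ?thesis
      proof (elim disjE bexE conjE)
        assume "monom [g, sg b] \<approx> (\<lambda>_. 0 :: 'r)"
        then show ?thesis using eqv_trans[OF gb] by blast
      next
        fix c assume c: "c \<in> mor" "s c = s b" "\<forall>i. d b i \<le> d c i + star_deg g i"
          and gc: "monom [g, sg b] \<approx> (monom [sg c] :: 'p kpgen list \<Rightarrow> 'r)"
        have "m i \<le> d c i" for i using spec[OF b(3), of i] spec[OF c(3), of i] by linarith
        then show ?thesis using eqv_trans[OF gb gc] c(1,2) b(2) by auto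
      qed
    qed
  qed
  then show ?case using dgN by (intro exI[of _ "\<lambda>i. N i + star_deg g i"]) blast
qed

text \<open>This provides the vertex at the right end of the word at which (KP4) can be inserted:
  the source of a last path, the range of a last starred path.\<close>

lemma last_source:
  assumes "set w \<subseteq> gens" "w \<noteq> []"
  obtains v where "v \<in> obj" "monom w \<approx> (monom (w @ [sg v]) :: 'p kpgen list \<Rightarrow> 'r::comm_ring_1)"
proof -
  obtain u g where w: "w = u @ [g]" using assms(2) by (metis append_butlast_last_id)
  have g: "g \<in> gens" "set u \<subseteq> gens" using assms w by auto
  from g(1) obtain v where v: "v \<in> obj" "monom [g] \<approx> (monom [g, sg v] :: 'p kpgen list \<Rightarrow> 'r)"
  proof (cases rule: gens_cases)
    case (1 l)
    then show ?thesis using that[of "s l"] eqv_sym[OF rel_source[of l]] by simp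
  next
    case (2 l)
    then show ?thesis using that[of "r l"] eqv_sym[OF rel_star_range[of l]] by simp
  qed
  then show ?thesis using that[of v] eqv_context_monom[OF v(2), of u "[]"] g w by simp
qed

text \<open>The one degree \<open>q\<close> of all starred paths makes the terms independent. With
  mixed degrees (KP4) would be a linear relation between them.\<close>

definition normal_form :: "(nat \<Rightarrow> nat) \<Rightarrow> ('p kpgen list \<Rightarrow> 'r::comm_ring_1) \<Rightarrow>
    ('p \<times> 'p) set \<Rightarrow> ('p \<times> 'p \<Rightarrow> 'r) \<Rightarrow> bool" where
  "normal_form q f P c \<longleftrightarrow> finite P \<and>
     (\<forall>p\<in>P. fst p \<in> mor \<and> snd p \<in> mor \<and> s (fst p) = s (snd p) \<and> d (snd p) = q) \<and>
     f \<approx> (\<lambda>z. \<Sum>p\<in>P. c p * monom [sg (fst p), st (snd p)] z)"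

lemma normal_form_eqv: "f \<approx> g \<Longrightarrow> normal_form q g P c \<Longrightarrow> normal_form q f P c"
  unfolding normal_form_def using eqv_trans by blast

lemma normal_form_zero: "normal_form q (\<lambda>_. 0) {} c"
  by (simp add: normal_form_def eqv_refl)

lemma normal_form_smult:
  "normal_form q f P c \<Longrightarrow> normal_form q (\<lambda>z. x * f z) P (\<lambda>p. x * c p)"
  unfolding normal_form_def
  using eqv_smult[of f "\<lambda>z. \<Sum>p\<in>P. c p * monom [sg (fst p), st (snd p)] z" x]
  by (simp add: sum_distrib_left mult.assoc)

text \<open>Coefficient functions are arbitrary outside their own sets of pairs, so both are cut off
  before they are added.\<close>

lemma normal_form_add:
  assumes "normal_form q f P c" "normal_form q g Q e"
  shows "normal_form q (\<lambda>z. f z + g z) (P \<union> Q) (\<lambda>p. (if p \<in> P then c p else 0) + (if p \<in> Q then e p else 0))"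
proof -
  let ?m = "\<lambda>p. monom [sg (fst p), st (snd p)]"
  have fin: "finite P" "finite Q" using assms by (auto simp: normal_form_def)
  have "(\<Sum>p\<in>P \<union> Q. ((if p \<in> P then c p else 0) + (if p \<in> Q then e p else 0)) * ?m p z) =
      (\<Sum>p\<in>P. c p * ?m p z) + (\<Sum>p\<in>Q. e p * ?m p z)" for z
  proof -
    have "(\<Sum>p\<in>P \<union> Q. (if p \<in> P then c p else 0) * ?m p z) = (\<Sum>p\<in>P. c p * ?m p z)"
      using fin by (intro sum.mono_neutral_cong_right) auto
    moreover have "(\<Sum>p\<in>P \<union> Q. (if p \<in> Q then e p else 0) * ?m p z) = (\<Sum>p\<in>Q. e p * ?m p z)"
      using fin by (intro sum.mono_neutral_cong_right) auto
    ultimately show ?thesis by (simp add: distrib_right sum.distrib)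
  qed
  then show ?thesis using assms unfolding normal_form_def by (auto intro: eqv_add)
qed

lemma normal_form_sum:
  "(\<And>i. i \<in> A \<Longrightarrow> \<exists>P c. normal_form q (f i) P c) \<Longrightarrow> \<exists>P c. normal_form q (\<lambda>z. \<Sum>i\<in>A. f i z) P c"
proof (induction A rule: infinite_finite_induct)
  case (insert a A)
  then obtain P c Q e where "normal_form q (f a) P c" "normal_form q (\<lambda>z. \<Sum>i\<in>A. f i z) Q e"
    by blast
  from normal_form_add[OF this] show ?case using insert(1,2) by auto
qed (simp_all, (rule exI, rule exI, rule normal_form_zero)+)

lemma normal_form_single:
  assumes "a \<in> mor" "b \<in> mor" "s a = s b" "d b = q"
  shows "normal_form q (monom [sg a, st b]) {(a, b)} (\<lambda>_. 1)"
  using assms by (simp add: normal_form_def eqv_refl)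

text \<open>By (KP4), \<open>w\<close> is the sum of the words \<open>w s_l s_l*\<close> over the
  paths \<open>l\<close> of degree \<open>q\<close>, and for large \<open>q\<close> each
  \<open>w s_l\<close> collapses to a single path or to 0. Having this for all large
  \<open>q\<close> allows different words to share one degree.\<close>

lemma normal_form_word:
  assumes w: "set w \<subseteq> gens" "w \<noteq> []"
  shows "\<exists>N. dg N \<and> (\<forall>q. dg q \<and> (\<forall>i. N i \<le> q i) \<longrightarrow>
    (\<exists>P c. normal_form q (monom w :: 'p kpgen list \<Rightarrow> 'r::comm_ring_1) P c))"
proof -
  obtain v where v: "v \<in> obj" "monom w \<approx> (monom (w @ [sg v]) :: 'p kpgen list \<Rightarrow> 'r)"
    using last_source[OF w] .
  obtain N where N: "dg N" "\<And>m a. a \<in> mor \<Longrightarrow> (\<forall>i. N i + m i \<le> d a i) \<Longrightarrow>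
      monom (w @ [sg a]) \<approx> (\<lambda>_. 0 :: 'r) \<or>
      (\<exists>b\<in>mor. s b = s a \<and> (\<forall>i. m i \<le> d b i) \<and>
         monom (w @ [sg a]) \<approx> (monom [sg b] :: 'p kpgen list \<Rightarrow> 'r))"
    using word_path[OF w(1), where ?'r = 'r] by blast
  have "\<exists>P c. normal_form q (monom w :: 'p kpgen list \<Rightarrow> 'r) P c"
    if q: "dg q" "\<forall>i. N i \<le> q i" for q
  proof -
    let ?A = "{l\<in>mor. r l = v \<and> d l = q}"
    have "monom (w @ [sg v]) \<approx> (\<lambda>z. \<Sum>l\<in>?A. monom (w @ [sg l, st l]) z :: 'r)"
      using eqv_context_sum[OF rel_vertex_sum[OF v(1) q(1)], of w "[]"] w(1) by simp
    with v(2) have eq: "monom w \<approx> (\<lambda>z. \<Sum>l\<in>?A. monom (w @ [sg l, st l]) z :: 'r)"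
      by (rule eqv_trans)
    have "\<exists>P c. normal_form q (monom (w @ [sg l, st l]) :: 'p kpgen list \<Rightarrow> 'r) P c"
      if l: "l \<in> ?A" for l
    proof -
      have "l \<in> mor" "\<forall>i. N i + 0 \<le> d l i" using l q by auto
      from N(2)[OF this] show ?thesis
      proof (elim disjE bexE conjE)
        assume z: "monom (w @ [sg l]) \<approx> (\<lambda>_. 0 :: 'r)"
        have "monom (w @ [sg l, st l]) \<approx> (\<lambda>_. 0 :: 'r)"
          using eqv_context_zero[OF z, of "[]" "[st l]"] l by simp
        then show ?thesis using normal_form_eqv normal_form_zero by blast
      next
        fix b assume b: "b \<in> mor" "s b = s l"
          and z: "monom (w @ [sg l]) \<approx> (monom [sg b] :: 'p kpgen list \<Rightarrow> 'r)"
        have "monom (w @ [sg l, st l]) \<approx> (monom [sg b, st l] :: 'p kpgen list \<Rightarrow> 'r)"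
          using eqv_context_monom[OF z, of "[]" "[st l]"] l by simp
        then show ?thesis using normal_form_eqv normal_form_single[of b l q] b l by blast
      qed
    qed
    then have "\<exists>P c. normal_form q (\<lambda>z. \<Sum>l\<in>?A. monom (w @ [sg l, st l]) z :: 'r) P c"
      by (rule normal_form_sum)
    then show ?thesis using normal_form_eqv[OF eq] by blast
  qed
  then show ?thesis using N(1) by blast
qed

lemma normal_form_exists:
  assumes f: "f \<in> fa_carrier gens" "f [] = (0 :: 'r::comm_ring_1)"
  shows "\<exists>q P c. dg q \<and> normal_form q f P c"
proof -
  let ?S = "{w. f w \<noteq> 0}"
  have S: "finite ?S" "\<And>w. w \<in> ?S \<Longrightarrow> set w \<subseteq> gens \<and> w \<noteq> []"
    using f by (auto simp: fa_carrier_def)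
  have "\<forall>w\<in>?S. \<exists>N. dg N \<and> (\<forall>q. dg q \<and> (\<forall>i. N i \<le> q i) \<longrightarrow>
    (\<exists>P c. normal_form q (monom w :: 'p kpgen list \<Rightarrow> 'r) P c))"
    by (intro ballI normal_form_word) (use S(2) in auto)
  from bchoice[OF this] obtain N where N: "\<forall>w\<in>?S. dg (N w) \<and> (\<forall>q. dg q \<and> (\<forall>i. N w i \<le> q i) \<longrightarrow>
    (\<exists>P c. normal_form q (monom w :: 'p kpgen list \<Rightarrow> 'r) P c))"
    by blast
  \<comment> \<open>The sum of the finitely many bounds is a degree above each of them.\<close>
  define q where "q = (\<lambda>i. \<Sum>w\<in>?S. N w i)"
  have q: "dg q" using N by (simp add: q_def dg_def)
  have "N w i \<le> q i" if "w \<in> ?S" for w i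
    unfolding q_def using member_le_sum[of w ?S "\<lambda>w. N w i"] that S(1) by simp
  then have "\<exists>P c. normal_form q (monom w :: 'p kpgen list \<Rightarrow> 'r) P c" if "w \<in> ?S" for w
    using N q that by blast
  then have "\<exists>P c. normal_form q (\<lambda>z. f w * monom w z) P c" if "w \<in> ?S" for w
    using normal_form_smult that by blast
  then have "\<exists>P c. normal_form q (\<lambda>z. \<Sum>w\<in>?S. f w * monom w z) P c" by (rule normal_form_sum)
  then show ?thesis using q expand_monom[OF S(1)] by metis
qed

section \<open>The infinite-path representation\<close>

text \<open>Without the degree in the second component the representation would not be faithful:
  if \<open>a x = x\<close> for all infinite paths \<open>x\<close>, it could not tell \<open>s_a\<close> from the vertex \<open>s(a)\<close>.\<close>

definition S_op :: "'p \<Rightarrow> ('p set \<times> (nat \<Rightarrow> int) \<Rightarrow> 'r::comm_ring_1) \<Rightarrow> 'p set \<times> (nat \<Rightarrow> int) \<Rightarrow> 'r"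
  where "S_op l h = (\<lambda>(X, n). if ipath X \<and> l \<in> X then h (sub l X, \<lambda>i. n i - int (d l i)) else 0)"

text \<open>As in \<open>S_op\<close>, the value is 0 at every set that is not an infinite path, so
  the relations hold at all points of the type.\<close>

definition T_op :: "'p \<Rightarrow> ('p set \<times> (nat \<Rightarrow> int) \<Rightarrow> 'r::comm_ring_1) \<Rightarrow> 'p set \<times> (nat \<Rightarrow> int) \<Rightarrow> 'r"
  where "T_op l h = (\<lambda>(X, n). if ipath X \<and> s l \<in> X then h (ext l X, \<lambda>i. n i + int (d l i)) else 0)"

primrec gen_op :: "'p kpgen \<Rightarrow> ('p set \<times> (nat \<Rightarrow> int) \<Rightarrow> 'r::comm_ring_1) \<Rightarrow> 'p set \<times> (nat \<Rightarrow> int) \<Rightarrow> 'r"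
  where
  "gen_op (Pv v) = S_op v"
| "gen_op (Sg l) = S_op l"
| "gen_op (Sst l) = T_op l"

primrec word_op :: "'p kpgen list \<Rightarrow> ('p set \<times> (nat \<Rightarrow> int) \<Rightarrow> 'r::comm_ring_1) \<Rightarrow> 'p set \<times> (nat \<Rightarrow> int) \<Rightarrow> 'r"
  where
  "word_op [] h = h"
| "word_op (g # w) h = gen_op g (word_op w h)"

definition rho :: "('p kpgen list \<Rightarrow> 'r) \<Rightarrow> ('p set \<times> (nat \<Rightarrow> int) \<Rightarrow> 'r::comm_ring_1)
    \<Rightarrow> 'p set \<times> (nat \<Rightarrow> int) \<Rightarrow> 'r"
  where "rho f h b = (\<Sum>w | f w \<noteq> 0. f w * word_op w h b)"

text \<open>This makes the operators respect the convention that \<open>s_v\<close>,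
  \<open>s_v*\<close> and \<open>p_v\<close> coincide.\<close>

lemma S_op_vertex: "v \<in> obj \<Longrightarrow> S_op v h = T_op v h"
  unfolding S_op_def T_op_def by (rule ext) (auto simp: sub_vertex ext_vertex)

lemma gen_op_sg [simp]: "gen_op (sg l) = S_op l"
  by (simp add: sgen_def)

lemma gen_op_st [simp]: "l \<in> mor \<Longrightarrow> gen_op (st l) = T_op l"
  using S_op_vertex[OF d_zero_vertex[of l]] by (auto simp: sstgen_def fun_eq_iff)

lemma S_op_comp:
  assumes "l \<in> mor" "m \<in> mor" "s l = r m"
  shows "S_op l (S_op m h) = S_op (l \<odot> m) h"
proof (rule ext, clarify)
  fix X n
  show "S_op l (S_op m h) (X, n) = S_op (l \<odot> m) h (X, n)"
  proof (cases "ipath X \<and> l \<in> X")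
    case True
    then show ?thesis
      using comp_in_iff[OF _ assms, of X] sub_comp[OF _ assms, of X] ipath_sub[of X l] assms
      by (auto simp: S_op_def algebra_simps)
  next
    case False
    then show ?thesis using comp_in_iff[OF _ assms, of X] by (auto simp: S_op_def)
  qed
qed

lemma T_op_comp:
  assumes "l \<in> mor" "m \<in> mor" "s l = r m"
  shows "T_op m (T_op l h) = T_op (l \<odot> m) h"
proof (rule ext, clarify)
  fix X n
  show "T_op m (T_op l h) (X, n) = T_op (l \<odot> m) h (X, n)"
  proof (cases "ipath X \<and> s m \<in> X")
    case True
    then show ?thesis
      using ext_comp_vertex[of X l m] ext_comp[of X l m] ipath_ext[of X m] s_comp[OF assms] 
        d_comp[OF assms] assms
      by (auto simp: T_op_def algebra_simps)
  next
    case False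
    then show ?thesis using s_comp[OF assms] by (auto simp: T_op_def)
  qed
qed

lemma S_op_vertices: "v \<in> obj \<Longrightarrow> w \<in> obj \<Longrightarrow> v \<noteq> w \<Longrightarrow> S_op v (S_op w h) = (\<lambda>_. 0)"
  unfolding S_op_def using ipath_unique[of _ v w] by (auto simp: fun_eq_iff sub_vertex)

lemma T_S_op:
  assumes "l \<in> mor" "m \<in> mor" "d l = d m"
  shows "T_op l (S_op m h) = (if l = m then S_op (s l) h else (\<lambda>_. 0))"
proof (rule ext, clarify)
  fix X n
  show "T_op l (S_op m h) (X, n) = (if l = m then S_op (s l) h else (\<lambda>_. 0)) (X, n)"
  proof (cases "ipath X \<and> s l \<in> X")
    case True
    then have "m \<in> ext l X \<longleftrightarrow> m = l" using ext_s_in assms by blast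
    then show ?thesis
      using True assms ipath_ext[of X l] sub_ext[of X l] sub_vertex[of X "s l"]
      by (auto simp: T_op_def S_op_def)
  next
    case False
    then show ?thesis by (auto simp: T_op_def S_op_def)
  qed
qed

lemma S_T_op:
  assumes "l \<in> mor"
  shows "S_op l (T_op l h) (X, n) = (if ipath X \<and> l \<in> X then h (X, n) else 0)"
  using ipath_sub[of X l] s_in_sub[of X l] ext_sub[of X l] by (simp add: S_op_def T_op_def)

text \<open>An infinite path with range \<open>v\<close> has exactly one initial segment of degree
  \<open>q\<close>, so exactly one summand is nonzero there. This is (KP4) for the
  operators.\<close>

lemma vertex_op_sum:
  assumes v: "v \<in> obj" and q: "dg q"
  shows "S_op v h b = (\<Sum>l\<in>{l\<in>mor. r l = v \<and> d l = q}. S_op l (T_op l h) b)"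
proof -
  let ?A = "{l\<in>mor. r l = v \<and> d l = q}"
  obtain X n where b: "b = (X, n)" by (cases b)
  have fin: "finite ?A" using finite_paths v q by blast
  have sum: "(\<Sum>l\<in>?A. S_op l (T_op l h) b) = (\<Sum>l\<in>?A. if ipath X \<and> l \<in> X then h (X, n) else 0)"
    unfolding b by (rule sum.cong) (simp_all add: S_T_op)
  show ?thesis
  proof (cases "ipath X \<and> v \<in> X")
    case True
    then obtain l0 where l0: "l0 \<in> X" "d l0 = q" using ipath_ex q by blast
    then have A: "l0 \<in> ?A" using True ipath_mor ipath_vertex_r v by blast
    have "(if ipath X \<and> l \<in> X then h (X, n) else 0) = (if l = l0 then h (X, n) else 0)"
      if "l \<in> ?A" for l
    proof -
      have "d l = d l0" using that l0 by simp
      then have "l \<in> X \<longleftrightarrow> l = l0" using l0(1) True ipath_unique[of X l l0] by blast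
      then show ?thesis using True by simp
    qed
    then have "(\<Sum>l\<in>?A. S_op l (T_op l h) b) = (\<Sum>l\<in>?A. if l = l0 then h (X, n) else 0)"
      unfolding sum by (rule sum.cong[OF refl])
    also have "\<dots> = h (X, n)" using fin A by (subst sum.delta) auto
    finally show ?thesis using True v by (simp add: b S_op_def sub_vertex)
  next
    case False
    then have "\<not> (ipath X \<and> l \<in> X)" if "l \<in> ?A" for l
      using that ipath_r[of X l] by blast
    then have "(\<Sum>l\<in>?A. S_op l (T_op l h) b) = 0" unfolding sum by (intro sum.neutral) auto
    then show ?thesis using False by (auto simp: b S_op_def)
  qed
qed

section \<open>Linearity and multiplicativity of the representation\<close>

lemma gen_op_sum: "gen_op g (\<lambda>b. \<Sum>i\<in>A. c i * h i b) = (\<lambda>b. \<Sum>i\<in>A. c i * gen_op g (h i) b)"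
  by (cases g) (auto simp: S_op_def T_op_def fun_eq_iff)

lemma word_op_sum: "word_op w (\<lambda>b. \<Sum>i\<in>A. c i * h i b) = (\<lambda>b. \<Sum>i\<in>A. c i * word_op w (h i) b)"
  by (induction w) (simp_all add: gen_op_sum)

lemma word_op_append: "word_op (u @ v) h = word_op u (word_op v h)"
  by (induction u) simp_all

lemma rho_linear: "rho f (\<lambda>b. \<Sum>i\<in>A. c i * h i b) = (\<lambda>b. \<Sum>i\<in>A. c i * rho f (h i) b)"
  unfolding rho_def word_op_sum sum_distrib_left
  by (rule ext, subst sum.swap) (simp add: ac_simps)

lemma rho_add_right: "rho f (\<lambda>b. h b + h' b) = (\<lambda>b. rho f h b + rho f h' b)"
  using rho_linear[of f "\<lambda>_. 1" "\<lambda>i. if i then h else h'" UNIV] by (simp add: UNIV_bool add.commute)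

lemma rho_smult_right: "rho f (\<lambda>b. c * h b) = (\<lambda>b. c * rho f h b)"
  using rho_linear[of f "\<lambda>_. c" "\<lambda>_. h" "{()}"] by simp

lemma rho_zero_right: "rho f (\<lambda>_. 0) = (\<lambda>_. 0)"
  using rho_linear[of f "\<lambda>_. 0" "\<lambda>_. undefined" "{}"] by simp

lemma rho_superset:
  assumes "finite A" "{w. f w \<noteq> 0} \<subseteq> A"
  shows "rho f h b = (\<Sum>w\<in>A. f w * word_op w h b)"
  unfolding rho_def using assms by (intro sum.mono_neutral_left) auto

lemma finite_support: "f \<in> fa_carrier G \<Longrightarrow> finite {w. f w \<noteq> 0}"
  by (simp add: fa_carrier_def)

lemma rho_add:
  assumes "f \<in> fa_carrier G" "g \<in> fa_carrier G"
  shows "rho (\<lambda>w. f w + g w) h b = rho f h b + rho g h b"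
proof -
  let ?A = "{w. f w \<noteq> 0} \<union> {w. g w \<noteq> 0}"
  have sub: "{w. f w + g w \<noteq> 0} \<subseteq> ?A" by auto
  have "finite ?A" using assms finite_support by blast
  then show ?thesis
    using rho_superset[of ?A f h b, OF _ Un_upper1] rho_superset[of ?A g h b, OF _ Un_upper2]
      rho_superset[of ?A "\<lambda>w. f w + g w" h b, OF _ sub]
    by (simp add: distrib_right sum.distrib)
qed

lemma rho_smult:
  assumes "f \<in> fa_carrier G"
  shows "rho (\<lambda>w. c * f w) h b = c * rho f h b"
proof -
  have "{w. c * f w \<noteq> 0} \<subseteq> {w. f w \<noteq> 0}" by auto
  from rho_superset[OF finite_support[OF assms] this, of h b] show ?thesis
    by (simp add: rho_def[of f] sum_distrib_left mult.assoc)
qed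

lemma rho_zero: "rho (\<lambda>_. 0) h = (\<lambda>_. 0)"
  by (simp add: rho_def fun_eq_iff)

lemma rho_sub:
  assumes "f \<in> fa_carrier G" "g \<in> fa_carrier G"
  shows "rho (fa_sub f g) h b = rho f h b - rho g h b"
  using rho_add[OF assms(1) smult_carrier[OF assms(2)], of "-1" h b] rho_smult[OF assms(2), of "-1" h b]
  by (simp add: fa_sub_def)

lemma rho_sum:
  assumes "\<And>i. i \<in> A \<Longrightarrow> f i \<in> fa_carrier G"
  shows "rho (\<lambda>w. \<Sum>i\<in>A. f i w) h b = (\<Sum>i\<in>A. rho (f i) h b)"
  using assms
proof (induction A rule: infinite_finite_induct)
  case (insert a A)
  then show ?case using rho_add[OF insert.prems sum_carrier, of a A f h b] by simp
qed (simp_all add: rho_zero)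

lemma rho_monom: "rho (monom w) h = word_op w h"
proof
  fix b
  have "{u. monom w u \<noteq> (0::'a)} = {w}" by (auto simp: monom_def)
  then show "rho (monom w) h b = word_op w h b" by (simp add: rho_def) (simp add: monom_def)
qed

lemma rho_mult:
  assumes "f \<in> fa_carrier G" "g \<in> fa_carrier G"
  shows "rho (fa_mult f g) h = rho f (rho g h)"
proof
  fix b
  let ?S = "{w. f w \<noteq> 0}" and ?T = "{w. g w \<noteq> 0}"
  let ?app = "\<lambda>p :: 'p kpgen list \<times> 'p kpgen list. fst p @ snd p"
  have fin: "finite ?S" "finite ?T" using assms finite_support by blast+
  have coeff: "fa_mult f g w = (\<Sum>p\<in>{p. p \<in> ?S \<times> ?T \<and> ?app p = w}. f (fst p) * g (snd p))" for w
    unfolding fa_mult_def using finite_splits[of w]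
    by (intro sum.mono_neutral_right) auto
  \<comment> \<open>Coefficients may cancel, so the support of the product can be smaller than the
    set of concatenations. Over this larger set the sum regroups into one over pairs of
    words.\<close>
  have "rho (fa_mult f g) h b = (\<Sum>w\<in>?app ` (?S \<times> ?T). fa_mult f g w * word_op w h b)"
    using fin fa_mult_support[of f g] by (intro rho_superset) auto
  also have "\<dots> = (\<Sum>w\<in>?app ` (?S \<times> ?T). \<Sum>p\<in>{p. p \<in> ?S \<times> ?T \<and> ?app p = w}.
      f (fst p) * g (snd p) * word_op (?app p) h b)"
    unfolding coeff sum_distrib_right by (intro sum.cong refl) auto
  also have "\<dots> = (\<Sum>p\<in>?S \<times> ?T. f (fst p) * g (snd p) * word_op (?app p) h b)"
    using fin by (intro sum.image_gen[symmetric]) auto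
  also have "\<dots> = (\<Sum>u\<in>?S. \<Sum>v\<in>?T. f u * g v * word_op (u @ v) h b)"
    by (simp add: sum.cartesian_product case_prod_unfold)
  also have "\<dots> = rho f (rho g h) b"
  proof -
    have "rho g h = (\<lambda>b. \<Sum>v\<in>?T. g v * word_op v h b)" by (simp add: rho_def fun_eq_iff)
    then show ?thesis
      by (simp add: rho_def[of f] word_op_sum word_op_append sum_distrib_left mult.assoc)
  qed
  finally show "rho (fa_mult f g) h b = rho f (rho g h) b" .
qed

lemma rho_rels:
  assumes "x \<in> kp_rels K k"
  shows "rho x h b = (0 :: 'r::comm_ring_1)"
proof -
  have sub: "rho (fa_sub f g) h b = 0"
    if "f \<in> fa_carrier gens" "g \<in> fa_carrier gens" "rho f h b = rho g h b"
    for f g :: "'p kpgen list \<Rightarrow> 'r"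
    using rho_sub[OF that(1,2)] that(3) by simp
  have car: "monom [sg l] \<in> fa_carrier gens" "monom [st l] \<in> fa_carrier gens" if "l \<in> mor" for l
    using that by (simp_all add: monom_carrier)
  from assms show ?thesis
    unfolding kp_rels_def fX_eq fY_eq fa_mult_monom
  proof (elim UnE CollectE exE conjE)
    fix v w assume *: "x = fa_sub (monom ([sg v] @ [sg w])) (if v = w then monom [sg v] else (\<lambda>_. 0))"
      "v \<in> obj" "w \<in> obj"
    show ?thesis unfolding *(1)
    proof (cases "v = w")
      case True
      show "rho (fa_sub (monom ([sg v] @ [sg w])) (if v = w then monom [sg v] else (\<lambda>_. 0))) h b = 0"
        by (rule sub) (use * True S_op_comp[of v v h] comp_r[of v] in \<open>auto simp: rho_monom monom_carrier\<close>)
    next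
      case False
      show "rho (fa_sub (monom ([sg v] @ [sg w])) (if v = w then monom [sg v] else (\<lambda>_. 0))) h b = 0"
        by (rule sub) (use * False S_op_vertices[of v w h] in
          \<open>auto simp: rho_monom rho_zero monom_carrier zero_carrier\<close>)
    qed
  next
    fix l m assume *: "x = fa_sub (monom ([sg l] @ [sg m])) (monom [sg (l \<odot> m)])"
      "l \<in> mor" "m \<in> mor" "r m = s l"
    show ?thesis unfolding *(1)
      by (rule sub) (use *(2-4) comp_mor[of l m] S_op_comp[of l m h] in \<open>auto simp: rho_monom monom_carrier\<close>)
  next
    fix l m assume *: "x = fa_sub (monom ([st m] @ [st l])) (monom [st (l \<odot> m)])"
      "l \<in> mor" "m \<in> mor" "r m = s l"
    show ?thesis unfolding *(1)
      by (rule sub) (use *(2-4) comp_mor[of l m] T_op_comp[of l m h] in \<open>auto simp: rho_monom monom_carrier\<close>)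
  next
    fix l assume *: "x = fa_sub (monom ([sg (r l)] @ [sg l])) (monom [sg l])" "l \<in> mor"
    show ?thesis unfolding *(1)
      by (rule sub) (use *(2) S_op_comp[of "r l" l h] in \<open>auto simp: rho_monom monom_carrier\<close>)
  next
    fix l assume *: "x = fa_sub (monom ([sg l] @ [sg (s l)])) (monom [sg l])" "l \<in> mor"
    show ?thesis unfolding *(1)
      by (rule sub) (use *(2) S_op_comp[of l "s l" h] in \<open>auto simp: rho_monom monom_carrier\<close>)
  next
    fix l assume *: "x = fa_sub (monom ([sg (s l)] @ [st l])) (monom [st l])" "l \<in> mor"
    show ?thesis unfolding *(1)
      by (rule sub) (use *(2) T_op_comp[of l "s l" h] S_op_vertex[of "s l" "T_op l h"] in \<open>auto simp: rho_monom monom_carrier\<close>)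
  next
    fix l assume *: "x = fa_sub (monom ([st l] @ [sg (r l)])) (monom [st l])" "l \<in> mor"
    show ?thesis unfolding *(1)
      by (rule sub) (use *(2) T_op_comp[of "r l" l h] S_op_vertex[of "r l" h] in \<open>auto simp: rho_monom monom_carrier\<close>)
  next
    fix l m assume *: "x = fa_sub (monom ([st l] @ [sg m])) (if l = m then monom [sg (s l)] else (\<lambda>_. 0))"
      "l \<in> mor" "m \<in> mor" "d l = d m"
    show ?thesis unfolding *(1)
      by (rule sub) (use *(2-4) T_S_op[of l m h] in
          \<open>auto simp: rho_monom rho_zero monom_carrier zero_carrier\<close>)
  next
    fix v n assume *: "x = fa_sub (monom [sg v])
        (\<lambda>w. \<Sum>l\<in>{l\<in>mor. r l = v \<and> d l = n}. monom ([sg l] @ [st l]) w)"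
      "v \<in> obj" "\<forall>i\<ge>k. n i = 0"
    have n: "dg n" using *(3) by (simp add: dg_def)
    have "rho (\<lambda>w. \<Sum>l\<in>{l\<in>mor. r l = v \<and> d l = n}. monom ([sg l] @ [st l]) w) h b =
        (\<Sum>l\<in>{l\<in>mor. r l = v \<and> d l = n}. rho (monom ([sg l] @ [st l])) h b)"
      by (rule rho_sum[where G = gens]) (auto intro!: monom_carrier)
    also have "\<dots> = (\<Sum>l\<in>{l\<in>mor. r l = v \<and> d l = n}. S_op l (T_op l h) b)"
      by (rule sum.cong) (simp_all add: rho_monom)
    also have "\<dots> = rho (monom [sg v]) h b"
      using vertex_op_sum[OF *(2) n, of h b] by (simp add: rho_monom)
    finally show ?thesis unfolding *(1) using *(2)
      by (intro sub) (auto intro!: monom_carrier sum_carrier)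
  qed
qed

lemma rho_ideal: "x \<in> kp_ideal K k \<Longrightarrow> rho x h = (\<lambda>_. 0)"
\<comment> \<open>\<open>h\<close> is generalized because in a right multiple \<open>x\<close> acts
  on \<open>rho a h\<close>.\<close>
proof (induction arbitrary: h rule: kp_ideal.induct)
  case (base x)
  then show ?case by (simp add: rho_rels fun_eq_iff)
next
  case (add x y)
  then show ?case using rho_add[OF ideal_carrier[OF add.hyps(1)] ideal_carrier[OF add.hyps(2)]]
    by (simp add: fun_eq_iff)
next
  case (lmult x a)
  then show ?case using rho_mult[OF lmult.hyps(2) ideal_carrier] by (simp add: rho_zero_right)
next
  case (rmult x a)
  then show ?case using rho_mult[OF ideal_carrier rmult.hyps(2)] by simp
qed (simp add: rho_zero)

lemma rho_eqv:
  assumes "f \<approx> g" "f \<in> fa_carrier gens" "g \<in> fa_carrier gens"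
  shows "rho f = rho g"
  using rho_ideal[of "fa_sub f g"] rho_sub[OF assms(2,3)] assms(1)
  by (simp add: eqv_def fun_eq_iff)

section \<open>Matrix entries and faithfulness\<close>

abbreviation point :: "'p set \<times> (nat \<Rightarrow> int) \<Rightarrow> 'p set \<times> (nat \<Rightarrow> int) \<Rightarrow> 'r::comm_ring_1"
  where "point p \<equiv> \<lambda>b. if b = p then 1 else 0"

text \<open>The entry in row \<open>a' X\<close> and column \<open>b' X\<close> of
  \<open>s_a s_b*\<close>. It vanishes unless \<open>a\<close> is an initial segment of
  \<open>a' X\<close>, and the integer coordinate excludes \<open>d a\<close> different from
  \<open>d a'\<close>; so \<open>a = a'\<close>. Then \<open>b X = b' X\<close>, and equal degrees
  give \<open>b = b'\<close>.\<close>

lemma S_T_point: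
  assumes ab: "a \<in> mor" "b \<in> mor" "s a = s b" and ab': "a' \<in> mor" "b' \<in> mor" "s a' = s b'"
    and q: "d b = d b'" and X: "ipath X" "s a' \<in> X"
  shows "S_op a (T_op b (point (ext b' X, \<lambda>_. 0))) (ext a' X, \<lambda>i. int (d a' i) - int (d b i)) =
    (if a = a' \<and> b = b' then 1 else 0 :: 'r::comm_ring_1)"
proof (cases "a \<in> ext a' X \<and> d a = d a'")
  case True
  then have a: "a = a'" using ext_s_in[OF X(1) ab'(1) ab(1) X(2)] by simp
  have b: "ext b X = ext b' X \<longleftrightarrow> b = b'"
    using ext_s_in[of X b' b] ext_self[of X b] ab ab' a q X by auto
  have "s b' \<in> X" "s b \<in> X" using X ab ab' a by auto
  then show ?thesis
    using a X ab ab' b ipath_ext[of X a'] sub_ext[of X a'] ext_self[of X a']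
    by (simp add: S_op_def T_op_def)
next
  case False
  have "a \<noteq> a'" using False ext_self[OF X(1) ab'(1) X(2)] by auto
  moreover have "S_op a (T_op b (point (ext b' X, \<lambda>_. 0))) (ext a' X, \<lambda>i. int (d a' i) - int (d b i)) = (0 :: 'r)"
  proof (cases "a \<in> ext a' X")
    case True
    then obtain j where "d a j \<noteq> d a' j" using False by blast
    then have "int (d a' j) - int (d b j) - int (d a j) + int (d b j) \<noteq> 0" by simp
    then have "(\<lambda>i. int (d a' i) - int (d b i) - int (d a i) + int (d b i)) \<noteq> (\<lambda>_. 0)"
      by metis
    then show ?thesis by (auto simp: S_op_def T_op_def)
  next
    case False
    then show ?thesis by (simp add: S_op_def)
  qed
  ultimately show ?thesis by simp
qed

lemma rho_normal_form:
  assumes "normal_form q f P c" "f \<in> fa_carrier gens"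
  shows "rho f h x = (\<Sum>p\<in>P. c p * S_op (fst p) (T_op (snd p) h) x)"
proof -
  have P: "finite P" "\<forall>p\<in>P. fst p \<in> mor \<and> snd p \<in> mor"
    and eq: "f \<approx> (\<lambda>z. \<Sum>p\<in>P. c p * monom [sg (fst p), st (snd p)] z)"
    using assms(1) by (auto simp: normal_form_def)
  have car: "monom [sg (fst p), st (snd p)] \<in> fa_carrier gens" if "p \<in> P" for p
    using P that by (intro monom_carrier) auto
  have "rho f h x = rho (\<lambda>z. \<Sum>p\<in>P. c p * monom [sg (fst p), st (snd p)] z) h x"
    using rho_eqv[OF eq assms(2) sum_carrier[OF smult_carrier[OF car]]] by simp
  also have "\<dots> = (\<Sum>p\<in>P. rho (\<lambda>z. c p * monom [sg (fst p), st (snd p)] z) h x)"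
    by (rule rho_sum[OF smult_carrier[OF car]])
  also have "\<dots> = (\<Sum>p\<in>P. c p * S_op (fst p) (T_op (snd p) h) x)"
    using P(2) by (intro sum.cong refl) (simp add: rho_smult[OF car] rho_monom)
  finally show ?thesis .
qed

text \<open>At this entry \<open>S_T_point\<close> removes every term but one, because all starred
  paths have degree \<open>q\<close>. The infinite path \<open>X\<close> behind \<open>s a\<close>
  can be chosen freely, which is used both for faithfulness and for the commutant.\<close>

lemma rho_coefficient:
  assumes nf: "normal_form q f P c" and f: "f \<in> fa_carrier gens"
    and p: "(a, b) \<in> P" and X: "ipath X" "s a \<in> X"
  shows "rho f (point (ext b X, \<lambda>_. 0)) (ext a X, \<lambda>i. int (d a i) - int (q i)) = c (a, b)"
proof -
  have P: "finite P" "\<And>p. p \<in> P \<Longrightarrow> fst p \<in> mor \<and> snd p \<in> mor \<and> s (fst p) = s (snd p) \<and> d (snd p) = q"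
    using nf by (auto simp: normal_form_def)
  note p' = P(2)[OF p, simplified]
  have "c x * S_op (fst x) (T_op (snd x) (point (ext b X, \<lambda>_. 0))) (ext a X, \<lambda>i. int (d a i) - int (q i))
      = (if x = (a, b) then c (a, b) else 0)" if "x \<in> P" for x
    using S_T_point[of "fst x" "snd x" a b X, where ?'r = 'a] P(2)[OF that] p' X by (auto simp: prod_eq_iff)
  then have "rho f (point (ext b X, \<lambda>_. 0)) (ext a X, \<lambda>i. int (d a i) - int (q i)) =
      (\<Sum>x\<in>P. if x = (a, b) then c (a, b) else 0)"
    unfolding rho_normal_form[OF nf f] by (rule sum.cong[OF refl])
  also have "\<dots> = c (a, b)" using P(1) p by (subst sum.delta) auto
  finally show ?thesis .
qed

text \<open>The vanishing constant term gives a normal form. Each of its coefficients is a matrix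
  entry at some infinite path through \<open>s a\<close>, hence 0.\<close>

lemma rho_faithful:
  assumes f: "f \<in> fa_carrier gens" "f [] = 0" and zero: "\<And>h. rho f h = (\<lambda>_. 0)"
  shows "f \<approx> (\<lambda>_. 0)"
proof -
  obtain q P c where nf: "normal_form q f P c" using normal_form_exists[OF f] by blast
  have "c (a, b) = 0" if p: "(a, b) \<in> P" for a b
  proof -
    have "a \<in> mor" using nf p by (auto simp: normal_form_def)
    then obtain X where "ipath X" "s a \<in> X" using ipath_exists[of "s a"] by auto
    from rho_coefficient[OF nf f(1) p this] show ?thesis by (simp add: zero)
  qed
  then have "(\<lambda>z. \<Sum>p\<in>P. c p * monom [sg (fst p), st (snd p)] z) = (\<lambda>_. 0)"
    by (intro ext sum.neutral) auto
  then show ?thesis using nf by (simp add: normal_form_def)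
qed

section \<open>The cycline subalgebra and the commutant of the diagonal\<close>

abbreviation "cls \<equiv> kp_cls K k"

lemma cls_eqI: "f \<approx> g \<Longrightarrow> cls f = cls g"
  unfolding kp_cls_def using eqv_trans eqv_sym unfolding eqv_def by blast

lemma rep_cls:
  assumes "f \<in> fa_carrier gens"
  shows "kp_rep (cls f) \<in> fa_carrier gens" "kp_rep (cls f) \<approx> f"
proof -
  have "f \<in> cls f" using assms eqv_refl[of f] by (simp add: kp_cls_def eqv_def)
  then have "kp_rep (cls f) \<in> cls f" unfolding kp_rep_def by (metis someI)
  then show "kp_rep (cls f) \<in> fa_carrier gens" "kp_rep (cls f) \<approx> f"
    by (simp_all add: kp_cls_def eqv_def)
qed

lemma kp_mult_cls:
  assumes "f \<in> fa_carrier gens" "g \<in> fa_carrier gens"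
  shows "kp_mult K k (cls f) (cls g) = cls (fa_mult f g)"
  unfolding kp_mult_def
  by (intro cls_eqI eqv_trans[OF eqv_mult_left[OF rep_cls(2)] eqv_mult_right[OF rep_cls(2)]] rep_cls assms)

lemma kp_add_cls:
  assumes "f \<in> fa_carrier gens" "g \<in> fa_carrier gens"
  shows "kp_add K k (cls f) (cls g) = cls (\<lambda>w. f w + g w)"
  unfolding kp_add_def by (intro cls_eqI eqv_add rep_cls assms)

lemma kp_smult_cls:
  assumes "f \<in> fa_carrier gens"
  shows "kp_smult K k c (cls f) = cls (\<lambda>w. c * f w)"
  unfolding kp_smult_def by (intro cls_eqI eqv_smult rep_cls assms)

text \<open>The chosen representative does not matter, since \<open>rho\<close> agrees on congruent
  elements of the carrier.\<close>

definition act :: "('p kpgen list \<Rightarrow> 'r) set \<Rightarrow> ('p set \<times> (nat \<Rightarrow> int) \<Rightarrow> 'r::comm_ring_1)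
    \<Rightarrow> 'p set \<times> (nat \<Rightarrow> int) \<Rightarrow> 'r"
  where "act x = rho (kp_rep x)"

lemma act_cls: "f \<in> fa_carrier gens \<Longrightarrow> act (cls f) = rho f"
  unfolding act_def by (intro rho_eqv rep_cls)

lemma KP_cases:
  assumes "x \<in> KP K k"
  obtains f where "f \<in> fa_carrier gens" "f [] = 0" "x = cls f"
  using assms by (auto simp: KP_def)

lemma cls_in_KP: "f \<in> fa_carrier gens \<Longrightarrow> f [] = 0 \<Longrightarrow> cls f \<in> KP K k"
  by (simp add: KP_def)

lemma KP_zero: "kp_zero K k \<in> KP K k"
  unfolding kp_zero_def by (intro cls_in_KP zero_carrier refl)

lemma KP_add: "x \<in> KP K k \<Longrightarrow> y \<in> KP K k \<Longrightarrow> kp_add K k x y \<in> KP K k"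
  by (elim KP_cases) (simp add: kp_add_cls cls_in_KP add_carrier)

lemma KP_mult: "x \<in> KP K k \<Longrightarrow> y \<in> KP K k \<Longrightarrow> kp_mult K k x y \<in> KP K k"
  by (elim KP_cases) (simp add: kp_mult_cls cls_in_KP fa_mult_carrier fa_mult_Nil)

lemma KP_smult: "x \<in> KP K k \<Longrightarrow> kp_smult K k c x \<in> KP K k"
  by (elim KP_cases) (simp add: kp_smult_cls cls_in_KP smult_carrier)

lemma act_zero: "act (kp_zero K k) h = (\<lambda>_. 0)"
  unfolding kp_zero_def act_cls[OF zero_carrier] by (rule rho_zero)

lemma act_add:
  assumes "x \<in> KP K k" "y \<in> KP K k"
  shows "act (kp_add K k x y) h = (\<lambda>b. act x h b + act y h b)"
  using assms by (elim KP_cases) (simp add: kp_add_cls act_cls add_carrier rho_add[where G = gens] fun_eq_iff)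

lemma act_smult:
  assumes "x \<in> KP K k"
  shows "act (kp_smult K k c x) h = (\<lambda>b. c * act x h b)"
  using assms by (elim KP_cases) (simp add: kp_smult_cls act_cls smult_carrier rho_smult[where G = gens] fun_eq_iff)

lemma act_mult:
  assumes "x \<in> KP K k" "y \<in> KP K k"
  shows "act (kp_mult K k x y) h = act x (act y h)"
  using assms by (elim KP_cases) (simp add: kp_mult_cls act_cls fa_mult_carrier rho_mult[where G = gens])

lemma act_inj:
  assumes "x \<in> KP K k" "y \<in> KP K k" "\<And>h. act x h = act y h"
  shows "x = y"
proof -
  obtain f where f: "f \<in> fa_carrier gens" "f [] = 0" "x = cls f" using KP_cases assms(1) .
  obtain g where g: "g \<in> fa_carrier gens" "g [] = 0" "y = cls g" using KP_cases assms(2) .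
  have "fa_sub f g \<approx> (\<lambda>_. 0)"
  proof (rule rho_faithful)
    show "fa_sub f g \<in> fa_carrier gens" "fa_sub f g [] = 0"
      using f g diff_carrier by (auto simp: fa_sub_def)
    show "rho (fa_sub f g) h = (\<lambda>_. 0)" for h
      using assms(3)[of h] f g by (simp add: fun_eq_iff rho_sub[where G = gens] act_cls)
  qed
  then have "f \<approx> g" by (simp add: eqv_def fa_sub_def)
  then show ?thesis using f g cls_eqI by simp
qed

section \<open>Generated subalgebras and commutation\<close>

lemma subalg_gen_KP:
  assumes "S \<subseteq> KP K k"
  shows "kp_subalg_gen K k S \<subseteq> KP K k"
proof
  fix x assume "x \<in> kp_subalg_gen K k S"
  then show "x \<in> KP K k"
    by induction (use assms in \<open>auto intro: KP_zero KP_add KP_mult KP_smult\<close>)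
qed

lemma subalg_gen_subalg:
  assumes "S \<subseteq> KP K k"
  shows "is_kp_subalg K k (kp_subalg_gen K k S)"
  unfolding is_kp_subalg_def using subalg_gen_KP[OF assms]
  by (auto intro: kp_subalg_gen.intros)

lemma commute_iff:
  assumes "x \<in> KP K k" "y \<in> KP K k"
  shows "kp_mult K k x y = kp_mult K k y x \<longleftrightarrow> (\<forall>h. act x (act y h) = act y (act x h))"
proof
  assume "kp_mult K k x y = kp_mult K k y x"
  then show "\<forall>h. act x (act y h) = act y (act x h)"
    using act_mult[OF assms] act_mult[OF assms(2,1)] by metis
next
  assume "\<forall>h. act x (act y h) = act y (act x h)"
  then show "kp_mult K k x y = kp_mult K k y x"
    using assms by (intro act_inj KP_mult) (simp_all add: act_mult)
qed

text \<open>The elements that commute with \<open>y\<close> form a subalgebra. In terms of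
  operators, closure under sums and scalars is the linearity of \<open>act y\<close>.\<close>

lemma commutes_subalg_gen:
  assumes S: "S \<subseteq> KP K k" and y: "y \<in> KP K k"
    and comm: "\<And>x. x \<in> S \<Longrightarrow> kp_mult K k x y = kp_mult K k y x"
    and x: "x \<in> kp_subalg_gen K k S"
  shows "kp_mult K k x y = kp_mult K k y x"
proof -
  have KP: "x \<in> KP K k" if "x \<in> kp_subalg_gen K k S" for x
    using subalg_gen_KP[OF S] that by blast
  have lin: "act y (\<lambda>b. h b + h' b) = (\<lambda>b. act y h b + act y h' b)"
    "act y (\<lambda>b. c * h b) = (\<lambda>b. c * act y h b)" "act y (\<lambda>_. 0) = (\<lambda>_. 0)" for h h' c
    by (simp_all add: act_def rho_add_right rho_smult_right rho_zero_right)
  from x have "act x (act y h) = act y (act x h)" for h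
  proof (induction arbitrary: h)
    case (gen x)
    then show ?case using comm commute_iff y S by blast
  next
    case (mult u v)
    then show ?case by (simp add: act_mult KP)
  qed (simp_all add: act_zero act_add act_smult lin KP)
  then show ?thesis using commute_iff KP[OF x] y by blast
qed

lemma subalg_gen_commutative:
  assumes S: "S \<subseteq> KP K k"
    and comm: "\<And>x y. x \<in> S \<Longrightarrow> y \<in> S \<Longrightarrow> kp_mult K k x y = kp_mult K k y x"
  shows "kp_commutative K k (kp_subalg_gen K k S)"
  unfolding kp_commutative_def
proof (intro ballI)
  fix x y assume xy: "x \<in> kp_subalg_gen K k S" "y \<in> kp_subalg_gen K k S"
  \<comment> \<open>Two passes: first \<open>x\<close> is shown to commute with each generator,
    then, with \<open>x\<close> fixed, with everything they generate.\<close>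
  have "kp_mult K k x z = kp_mult K k z x" if "z \<in> S" for z
    using commutes_subalg_gen[OF S _ _ xy(1), of z] comm that S by blast
  then show "kp_mult K k x y = kp_mult K k y x"
    using commutes_subalg_gen[OF S _ _ xy(2), of x] subalg_gen_KP[OF S] xy by fastforce
qed

lemma subalg_gen_mono: "S \<subseteq> T \<Longrightarrow> kp_subalg_gen K k S \<subseteq> kp_subalg_gen K k T"
proof
  fix x assume "S \<subseteq> T" "x \<in> kp_subalg_gen K k S"
  from this(2,1) show "x \<in> kp_subalg_gen K k T"
    by induction (auto intro: kp_subalg_gen.intros)
qed

section \<open>Cycline pairs in terms of infinite paths\<close>

abbreviation E :: "'p \<Rightarrow> 'p \<Rightarrow> ('p kpgen list \<Rightarrow> 'r::comm_ring_1) set"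
  where "E a b \<equiv> kp_mult K k (kp_s K k a) (kp_sst K k b)"

lemma monom_pair_carrier: "a \<in> mor \<Longrightarrow> b \<in> mor \<Longrightarrow> monom [sg a, st b] \<in> fa_carrier gens"
  by (intro monom_carrier) simp

lemma E_eq: "a \<in> mor \<Longrightarrow> b \<in> mor \<Longrightarrow> E a b = cls (monom [sg a, st b])"
  unfolding kp_s_def kp_sst_def fX_eq fY_eq
  by (subst kp_mult_cls) (simp_all add: monom_carrier fa_mult_monom)

lemma E_KP: "a \<in> mor \<Longrightarrow> b \<in> mor \<Longrightarrow> E a b \<in> KP K k"
  unfolding E_eq by (intro cls_in_KP monom_pair_carrier) (auto simp: monom_def)

lemma act_E: "a \<in> mor \<Longrightarrow> b \<in> mor \<Longrightarrow> act (E a b) h = S_op a (T_op b h)"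
  by (simp add: E_eq act_cls monom_pair_carrier rho_monom)

text \<open>\<open>s_l s_l*\<close> acts as restriction to the infinite paths that begin with
  \<open>l\<close>, and the action is faithful.\<close>

lemma projection_eq_iff:
  assumes "l \<in> mor" "m \<in> mor"
  shows "E l l = (E m m :: ('p kpgen list \<Rightarrow> 'r::comm_ring_1) set) \<longleftrightarrow>
    (\<forall>X. ipath X \<longrightarrow> (l \<in> X \<longleftrightarrow> m \<in> X))"
proof
  assume eq: "E l l = (E m m :: ('p kpgen list \<Rightarrow> 'r) set)"
  show "\<forall>X. ipath X \<longrightarrow> (l \<in> X \<longleftrightarrow> m \<in> X)"
  proof (intro allI impI)
    fix X assume X: "ipath X"
    \<comment> \<open>The constant function 1 detects membership, as 1 and 0 differ in the
      ring.\<close>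
    have "S_op l (T_op l (\<lambda>_. 1 :: 'r)) (X, \<lambda>_. 0) = S_op m (T_op m (\<lambda>_. 1)) (X, \<lambda>_. 0)"
      using eq act_E[of l l "\<lambda>_. 1 :: 'r"] act_E[of m m "\<lambda>_. 1 :: 'r"] assms by simp
    then show "l \<in> X \<longleftrightarrow> m \<in> X" using X assms by (simp add: S_T_op split: if_splits)
  qed
next
  assume "\<forall>X. ipath X \<longrightarrow> (l \<in> X \<longleftrightarrow> m \<in> X)"
  then show "E l l = (E m m :: ('p kpgen list \<Rightarrow> 'r) set)"
    using assms by (intro act_inj E_KP) (auto simp: act_E S_T_op fun_eq_iff)
qed

text \<open>With \<open>Y\<close> the rest of \<open>X\<close> behind \<open>a g\<close>, the
  hypothesis applied to the infinite path \<open>g Y\<close> gives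
  \<open>X = a g Y = b g Y\<close>.\<close>

lemma ext_eq_transfer:
  assumes ab: "a \<in> mor" "b \<in> mor" "s a = s b"
    and eq: "\<And>X. ipath X \<Longrightarrow> s a \<in> X \<Longrightarrow> ext a X = ext b X"
    and g: "g \<in> mor" "r g = s a" and X: "ipath X" "a \<odot> g \<in> X"
  shows "b \<odot> g \<in> X"
proof -
  let ?Y = "sub (a \<odot> g) X"
  have Y: "ipath ?Y" "s g \<in> ?Y"
    using ipath_sub[OF X] s_in_sub[OF X] s_comp[OF ab(1) g(1)] g(2) by simp_all
  have "X = ext (a \<odot> g) ?Y" using ext_sub[OF X] by simp
  also have "\<dots> = ext a (ext g ?Y)" using ext_comp[OF Y(1) ab(1) g(1) _ Y(2)] g(2) by simp
  also have "\<dots> = ext b (ext g ?Y)"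
    using eq[OF ipath_ext[OF Y(1) g(1) Y(2)]] ext_comp_vertex[OF Y(1) ab(1) g(1) _ Y(2)] g(2) by simp
  also have "\<dots> = ext (b \<odot> g) ?Y"
    using ext_comp[OF Y(1) ab(2) g(1) _ Y(2)] g(2) ab(3) by simp
  finally have "X = ext (b \<odot> g) ?Y" .
  moreover have "b \<odot> g \<in> ext (b \<odot> g) ?Y"
    using ext_self[OF Y(1), of "b \<odot> g"] comp_mor[OF ab(2) g(1)] s_comp[OF ab(2) g(1)] g(2) ab(3) Y(2)
    by simp
  ultimately show ?thesis by blast
qed

text \<open>If the projections agree, every \<open>b g\<close> with \<open>g\<close> in
  \<open>X\<close> lies in \<open>a X\<close>, so \<open>b X\<close> is contained in
  \<open>a X\<close>, and one inclusion suffices. The converse is \<open>ext_eq_transfer\<close> in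
  both directions. In particular the notion is the same for every coefficient ring.\<close>

lemma cycline_iff:
  "cycline_pair K k TYPE('r::comm_ring_1) a b \<longleftrightarrow>
     a \<in> mor \<and> b \<in> mor \<and> s a = s b \<and> (\<forall>X. ipath X \<and> s a \<in> X \<longrightarrow> ext a X = ext b X)"
    (is "?C \<longleftrightarrow> ?R")
proof
  assume C: ?C
  then have ab: "a \<in> mor" "b \<in> mor" "s a = s b" by (auto simp: cycline_pair_def)
  have "ext a X = ext b X" if X: "ipath X" "s a \<in> X" for X
  proof -
    have Xb: "s b \<in> X" using X ab by simp
    have "ext b X \<subseteq> ext a X"
    proof
      fix m assume "m \<in> ext b X"
      then obtain g where g: "g \<in> X" "m \<preceq> b \<odot> g" by (auto simp: ext_def)
      have g': "g \<in> mor" "s a = r g" using ipath_mor X g ext_r ab by blast+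
      then have "E (a \<odot> g) (a \<odot> g) = (E (b \<odot> g) (b \<odot> g) :: ('p kpgen list \<Rightarrow> 'r) set)"
        using C by (simp add: cycline_pair_def)
      then have "b \<odot> g \<in> ext a X"
        using projection_eq_iff[of "a \<odot> g" "b \<odot> g", where ?'r = 'r] ab g' comp_mor ipath_ext[OF X(1) ab(1) X(2)]
          in_ext[OF X(1) ab(1) X(2) g(1)] by metis
      then show "m \<in> ext a X" using ipath_pre[OF ipath_ext[OF X(1) ab(1) X(2)]] g(2) by blast
    qed
    then show ?thesis
      using ipath_subset_eq[OF ipath_ext[OF X(1) ab(2) Xb] ipath_ext[OF X(1) ab(1) X(2)]] by simp
  qed
  then show ?R using ab by blast
next
  assume R: ?R
  then have ab: "a \<in> mor" "b \<in> mor" "s a = s b"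
    and eq: "\<And>X. ipath X \<Longrightarrow> s a \<in> X \<Longrightarrow> ext a X = ext b X" by blast+
  have "E (a \<odot> g) (a \<odot> g) = (E (b \<odot> g) (b \<odot> g) :: ('p kpgen list \<Rightarrow> 'r) set)"
    if g: "g \<in> mor" "r g = s a" for g
  proof -
    have "a \<odot> g \<in> mor" "b \<odot> g \<in> mor" using comp_mor ab g by metis+
    moreover have "a \<odot> g \<in> X \<longleftrightarrow> b \<odot> g \<in> X" if "ipath X" for X
      using ext_eq_transfer[OF ab eq g that] ext_eq_transfer[OF ab(2,1) ab(3)[symmetric] _ g(1) _ that]
        eq g(2) ab(3) by metis
    ultimately show ?thesis using projection_eq_iff by blast
  qed
  then show ?C using ab unfolding cycline_pair_def by blast
qed

lemma cycline_refl: "l \<in> mor \<Longrightarrow> cycline_pair K k TYPE('r::comm_ring_1) l l"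
  by (simp add: cycline_iff)

text \<open>With \<open>Y\<close> the rest of \<open>X\<close> behind \<open>a\<close>, removing
  \<open>a\<close> and prepending \<open>b\<close> gives \<open>b Y = a Y = X\<close>, so only the
  integer coordinate moves.\<close>

lemma act_cycline:
  assumes "cycline_pair K k TYPE('r::comm_ring_1) a b"
  shows "act (E a b) (h :: _ \<Rightarrow> 'r) (X, n) =
    (if ipath X \<and> a \<in> X then h (X, \<lambda>i. n i - int (d a i) + int (d b i)) else 0)"
proof -
  have ab: "a \<in> mor" "b \<in> mor" "s a = s b" "\<And>X. ipath X \<and> s a \<in> X \<Longrightarrow> ext a X = ext b X"
    using assms unfolding cycline_iff by blast+
  show ?thesis
  proof (cases "ipath X \<and> a \<in> X")
    case True
    then have "ipath (sub a X)" "s a \<in> sub a X" "ext b (sub a X) = X"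
      using ipath_sub s_in_sub ext_sub ab(4)[of "sub a X"] by metis+
    then show ?thesis using True ab by (simp add: act_E S_op_def T_op_def)
  next
    case False
    then show ?thesis using ab by (auto simp: act_E S_op_def)
  qed
qed

section \<open>Commutativity of \<open>M\<close> and the two inclusions\<close>

lemma cycline_KP:
  "{E a b | a b. cycline_pair K k TYPE('r::comm_ring_1) a b} \<subseteq> (KP K k :: ('p kpgen list \<Rightarrow> 'r) set set)"
  by (auto simp: cycline_iff intro: E_KP)

lemma M_subalg: "is_kp_subalg K k (kp_M K k :: ('p kpgen list \<Rightarrow> 'r::comm_ring_1) set set)"
  unfolding kp_M_def by (rule subalg_gen_subalg[OF cycline_KP])

lemma M_commutative: "kp_commutative K k (kp_M K k :: ('p kpgen list \<Rightarrow> 'r::comm_ring_1) set set)"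
  unfolding kp_M_def
proof (rule subalg_gen_commutative[OF cycline_KP])
  fix x y :: "('p kpgen list \<Rightarrow> 'r) set"
  assume "x \<in> {E a b | a b. cycline_pair K k TYPE('r) a b}"
    "y \<in> {E a b | a b. cycline_pair K k TYPE('r) a b}"
  then obtain a b a' b' where x: "x = E a b" "cycline_pair K k TYPE('r) a b"
    and y: "y = E a' b'" "cycline_pair K k TYPE('r) a' b'" by blast
  have KP: "x \<in> KP K k" "y \<in> KP K k" using x y cycline_KP by blast+
  \<comment> \<open>In either order the value at \<open>X\<close> is 0 unless \<open>a\<close> and
    \<open>a'\<close> both lie in \<open>X\<close>, and the shifts of the integer coordinate add
    up.\<close>
  have "act x (act y h) = act y (act x h)" for h
    by (auto simp: fun_eq_iff x(1) y(1) act_cycline[OF x(2)] act_cycline[OF y(2)] algebra_simps)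
  then show "kp_mult K k x y = kp_mult K k y x" using commute_iff[OF KP] by blast
qed

lemma D_subset_M: "kp_D K k \<subseteq> (kp_M K k :: ('p kpgen list \<Rightarrow> 'r::comm_ring_1) set set)"
  unfolding kp_D_def kp_M_def by (rule subalg_gen_mono) (auto intro: cycline_refl)

text \<open>Since \<open>B\<close> contains \<open>D\<close>, its elements commute with
  \<open>D\<close>. With \<open>B = M\<close> this gives one inclusion of the theorem, and with
  arbitrary \<open>B\<close> the maximality.\<close>

lemma commutative_subset_commutant:
  fixes B :: "('p kpgen list \<Rightarrow> 'r::comm_ring_1) set set"
  assumes "is_kp_subalg K k B" "kp_commutative K k B" "kp_M K k \<subseteq> B"
  shows "B \<subseteq> kp_D_commutant K k"
  using assms D_subset_M unfolding is_kp_subalg_def kp_commutative_def kp_D_commutant_def by blast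

lemma sum_in_M:
  fixes c :: "'p \<times> 'p \<Rightarrow> 'r::comm_ring_1"
  assumes "finite P" "\<And>p. p \<in> P \<Longrightarrow> cycline_pair K k TYPE('r) (fst p) (snd p)"
  shows "cls (\<lambda>z. \<Sum>p\<in>P. c p * monom [sg (fst p), st (snd p)] z) \<in> kp_M K k"
  using assms
proof (induction P)
  case empty
  then show ?case using kp_subalg_gen.zero unfolding kp_M_def kp_zero_def by simp
next
  case (insert p P)
  let ?m = "\<lambda>p. monom [sg (fst p), st (snd p)] :: 'p kpgen list \<Rightarrow> 'r"
  have mor: "fst x \<in> mor \<and> snd x \<in> mor" if "x \<in> insert p P" for x
    using insert.prems[OF that] by (simp add: cycline_iff)
  then have car: "?m x \<in> fa_carrier gens" if "x \<in> insert p P" for x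
    using that by (blast intro: monom_pair_carrier)
  have sum: "(\<lambda>z. \<Sum>x\<in>P. c x * ?m x z) \<in> fa_carrier gens"
    by (rule sum_carrier[OF smult_carrier[OF car]]) simp
  have "E (fst p) (snd p) \<in> (kp_M K k :: ('p kpgen list \<Rightarrow> 'r) set set)"
    unfolding kp_M_def using insert.prems[OF insertI1]
    by (intro kp_subalg_gen.gen CollectI exI[of _ "fst p"] exI[of _ "snd p"] conjI refl)
  then have "cls (?m p) \<in> kp_M K k" using mor[of p] by (simp add: E_eq)
  then have "cls (\<lambda>z. c p * ?m p z) \<in> kp_M K k"
    using kp_subalg_gen.smult[of "cls (?m p)" K k _ "c p"] kp_smult_cls[OF car[of p], of "c p"]
    unfolding kp_M_def by simp
  moreover have "cls (\<lambda>z. \<Sum>x\<in>P. c x * ?m x z) \<in> kp_M K k"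
    using insert.IH insert.prems by blast
  ultimately have "kp_add K k (cls (\<lambda>z. c p * ?m p z)) (cls (\<lambda>z. \<Sum>x\<in>P. c x * ?m x z)) \<in> kp_M K k"
    unfolding kp_M_def by (rule kp_subalg_gen.add)
  then show ?case
    using kp_add_cls[OF smult_carrier[OF car[of p], of "c p"] sum] insert.hyps by simp
qed

lemma commutant_cycline:
  fixes f :: "'p kpgen list \<Rightarrow> 'r::comm_ring_1"
  assumes f: "f \<in> fa_carrier gens" "f [] = 0" "cls f \<in> kp_D_commutant K k"
    and nf: "normal_form q f P c" and p: "p \<in> P" "c p \<noteq> 0"
  shows "cycline_pair K k TYPE('r) (fst p) (snd p)"
proof -
  obtain a b where ab: "p = (a, b)" by (cases p)
  then have mor: "a \<in> mor" "b \<in> mor" "s a = s b" using nf p by (auto simp: normal_form_def)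
  have "ext a X = ext b X" if X: "ipath X" "s a \<in> X" for X
  proof (rule ccontr)
    assume neq: "ext a X \<noteq> ext b X"
    have Xb: "s b \<in> X" using X mor by simp
    \<comment> \<open>Distinct infinite paths are never contained in each other, so
      \<open>a X\<close> has an initial segment that \<open>b X\<close> lacks.\<close>
    obtain m where m: "m \<in> ext a X" "m \<notin> ext b X"
      using neq ipath_subset_eq[OF ipath_ext[OF X(1) mor(1) X(2)] ipath_ext[OF X(1) mor(2) Xb]] by blast
    have mm: "m \<in> mor" using m(1) by (auto simp: ext_def pre_mor)
    let ?h = "point (ext b X, \<lambda>_. 0) :: _ \<Rightarrow> 'r"
    let ?y = "(ext a X, \<lambda>i. int (d a i) - int (q i))"
    have "E m m \<in> (kp_D K k :: ('p kpgen list \<Rightarrow> 'r) set set)"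
      unfolding kp_D_def using mm by (intro kp_subalg_gen.gen CollectI exI[of _ m] conjI refl)
    then have "kp_mult K k (cls f) (E m m) = kp_mult K k (E m m) (cls f)"
      using f(3) by (simp add: kp_D_commutant_def)
    then have "act (cls f) (act (E m m) ?h) = act (E m m) (act (cls f) ?h)"
      unfolding commute_iff[OF cls_in_KP[OF f(1,2)] E_KP[OF mm mm]] by (rule spec)
    then have "rho f (S_op m (T_op m ?h)) ?y = S_op m (T_op m (rho f ?h)) ?y"
      unfolding act_E[OF mm mm] act_cls[OF f(1)] by (rule fun_cong)
    \<comment> \<open>Applied first, the projection \<open>s_m s_m*\<close> kills the point mass at
      \<open>b X\<close>; applied last, it keeps the value at \<open>a X\<close>, which is the
      coefficient.\<close>
    moreover have "S_op m (T_op m ?h) = (\<lambda>_. 0)"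
      using m(2) by (auto simp: fun_eq_iff S_T_op[OF mm])
    moreover have "S_op m (T_op m (rho f ?h)) ?y = c p"
      using rho_coefficient[OF nf f(1) _ X] p(1) ab m(1) ipath_ext[OF X(1) mor(1) X(2)]
      by (simp add: S_T_op[OF mm])
    ultimately show False using p(2) by (simp add: rho_zero_right)
  qed
  then show ?thesis using mor ab by (auto simp: cycline_iff)
qed

lemma commutant_subset_M:
  "kp_D_commutant K k \<subseteq> (kp_M K k :: ('p kpgen list \<Rightarrow> 'r::comm_ring_1) set set)"
proof
  fix x :: "('p kpgen list \<Rightarrow> 'r) set"
  assume x: "x \<in> kp_D_commutant K k"
  then obtain f where f: "f \<in> fa_carrier gens" "f [] = 0" "x = cls f"
    using KP_cases[of x] by (auto simp: kp_D_commutant_def)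
  obtain q P c where nf: "normal_form q f P c" using normal_form_exists[OF f(1,2)] by blast
  \<comment> \<open>Pairs with coefficient 0 may fail to be cycline and are dropped.\<close>
  let ?P = "{p \<in> P. c p \<noteq> 0}"
  have P: "finite P" "f \<approx> (\<lambda>z. \<Sum>p\<in>P. c p * monom [sg (fst p), st (snd p)] z)"
    using nf by (auto simp: normal_form_def)
  have "(\<Sum>p\<in>P. c p * monom [sg (fst p), st (snd p)] z) = (\<Sum>p\<in>?P. c p * monom [sg (fst p), st (snd p)] z)"
    for z
    using P(1) by (intro sum.mono_neutral_right) auto
  then have "x = cls (\<lambda>z. \<Sum>p\<in>?P. c p * monom [sg (fst p), st (snd p)] z)"
    using cls_eqI[OF P(2)] f(3) by simp
  also have "\<dots> \<in> kp_M K k"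
    using P(1) commutant_cycline[OF f(1,2) _ nf] x f(3) by (intro sum_in_M) auto
  finally show "x \<in> kp_M K k" .
qed

end

theorem theorem4p6:
  fixes K :: "'p kgraph" and k :: nat
  assumes "is_kgraph K k"
    and "row_finite_no_sources K k"
  shows "(kp_M K k :: ('p kpgen list \<Rightarrow> 'r::comm_ring_1) set set) = kp_D_commutant K k
         \<and> is_kp_subalg K k (kp_M K k :: ('p kpgen list \<Rightarrow> 'r) set set)
         \<and> kp_commutative K k (kp_M K k :: ('p kpgen list \<Rightarrow> 'r) set set)
         \<and> (\<forall>B :: ('p kpgen list \<Rightarrow> 'r) set set.
              is_kp_subalg K k B \<and> kp_commutative K k B \<and> kp_M K k \<subseteq> B \<longrightarrow> B = kp_M K k)"
proof -
  interpret rf_kgraph K k using assms by unfold_locales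
  \<comment> \<open>\<open>M\<close> is itself one of the commutative subalgebras that contain
    \<open>M\<close>.\<close>
  have "kp_M K k \<subseteq> (kp_D_commutant K k :: ('p kpgen list \<Rightarrow> 'r) set set)"
    using commutative_subset_commutant[OF M_subalg M_commutative] by blast
  with commutant_subset_M have "(kp_M K k :: ('p kpgen list \<Rightarrow> 'r) set set) = kp_D_commutant K k"
    by blast
  then show ?thesis
    using M_subalg M_commutative commutative_subset_commutant[where ?'r = 'r] by blast
qed

end
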